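(* Let $f\in C(\mathbb{T})$, $\alpha>0$, and $c(\alpha)=1+\frac{3}{2\alpha^2}$. Then for every $n\in\mathbb{N}=\{1,2,\dots\}$, $$E_{n-1}(f)\le c(\alpha)\,W_2^*\bigl(f,\chi_{\alpha/(2n)}^2\bigr)$$ and $$E_{n-1}(f)\le 2c(\alpha)\,W_2^*\bigl(f,\chi_{\alpha/(2n)}\bigr).$$
   Context: $C(\mathbb{T})$, $\mathbb{T}=\mathbb{R}/\mathbb{Z}$, is the space of real continuous $1$-periodic functions with the uniform norm $\|f\|=\sup_{u\in\mathbb{T}}|f(u)|$. $T_{n-1}$ is the set of real trigonometric $1$-periodic polynomials of degree at most $n-1$, i.e. $\tau(t)=\sum_{j=-n+1}^{n-1}\alpha_j\exp(2\pi i j t)$ with complex coefficients satisfying $\alpha_j=\overline{\alpha_{-j}}$, and $E_{n-1}(f)=\inf_{\tau\in T_{n-1}}\|f-\tau\|$. For a periodic $f$ and a nonnegative integrable $g$ with bounded support on $\mathbb{R}$, $(f*g)(t)=\int_{\mathbb{R}}f(u)\,g(t-u)\,du$. For $h>0$, $\chi_h$ is the function on $\mathbb{R}$ equal to $1/h$ on $(-h/2,h/2)$ and $0$ elsewhere; $\chi_h^1=\chi_h$ and $\chi_h^k=\chi_h^{k-1}*\chi_h$ for $k\ge 2$ are its convolution powers (convolution on $\mathbb{R}$); in particular $\chi_h^2(t)=\frac1h\left(1-\frac{|t|}{h}\right)$ for $|t|<h$ and $0$ otherwise. Define $$W_2(f,\chi_h^k)=\|f-f*\chi_h^k\|,\qquad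 W_2^*(f,\chi_h^k)=\sup_{0<u\le h}W_2(f,\chi_u^k).$$ *)

theory Defs
  imports "HOL-Analysis.Analysis"
begin

text \<open>Functions on the circle \<open>\<real>/\<int>\<close> are 1-periodic functions on the real line.\<close>

definition C_T :: "(real \<Rightarrow> real) set" where
  "C_T = {f. continuous_on UNIV f \<and> (\<forall>t. f (t + 1) = f t)}"

text \<open>For a 1-periodic function, the supremum over the real line is the one over the circle.
  It is used only for bounded functions; its value elsewhere is irrelevant.\<close>

definition unorm :: "(real \<Rightarrow> real) \<Rightarrow> real" where
  "unorm f = (SUP u. \<bar>f u\<bar>)"

definition trig_polys :: "nat \<Rightarrow> (real \<Rightarrow> real) set" where
  "trig_polys m = {\<tau>. \<exists>a :: int \<Rightarrow> complex.
     (\<forall>j\<in>{- int m..int m}. a j = cnj (a (- j))) \<and>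
     (\<forall>t. complex_of_real (\<tau> t) =
        (\<Sum>j = - int m..int m. a j * exp (2 * of_real pi * \<i> * of_int j * of_real t)))}"

definition best_approx :: "nat \<Rightarrow> (real \<Rightarrow> real) \<Rightarrow> real" where
  "best_approx m f = (INF \<tau>\<in>trig_polys m. unorm (\<lambda>t. f t - \<tau> t))"

definition conv :: "(real \<Rightarrow> real) \<Rightarrow> (real \<Rightarrow> real) \<Rightarrow> real \<Rightarrow> real" where
  "conv f g t = (\<integral>u. f u * g (t - u) \<partial>lborel)"

definition chi :: "real \<Rightarrow> real \<Rightarrow> real" where
  "chi h t = (if - h / 2 < t \<and> t < h / 2 then 1 / h else 0)"

text \<open>Convolution powers of \<^term>\<open>chi h\<close>; they are defined for exponents at least 1, so the
  value at exponent 0 is a dummy.\<close>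

fun chi_pow :: "nat \<Rightarrow> real \<Rightarrow> real \<Rightarrow> real" where
  "chi_pow 0 h = (\<lambda>t. 0)"
| "chi_pow (Suc 0) h = chi h"
| "chi_pow (Suc (Suc k)) h = conv (chi_pow (Suc k) h) (chi h)"

definition W2 :: "(real \<Rightarrow> real) \<Rightarrow> (real \<Rightarrow> real) \<Rightarrow> real" where
  "W2 f g = unorm (\<lambda>t. f t - conv f g t)"

text \<open>\<open>W2_star f k h\<close> stands for $W_2^*(f, \chi_h^k)$.\<close>

definition W2_star :: "(real \<Rightarrow> real) \<Rightarrow> nat \<Rightarrow> real \<Rightarrow> real" where
  "W2_star f k h = (SUP u\<in>{0<..h}. W2 f (chi_pow k u))"

end

theory Submission
  imports Defs
begin

text \<open>
  Put \<open>h = \<alpha> / (2 n)\<close> and \<open>W = W\<^sub>2\<^sup>*(f, \<chi>\<^sub>h\<^sup>2)\<close>. A suitable average \<open>g\<close> of the convolutions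
  \<open>f * \<chi>\<^sub>u\<^sup>2\<close> over \<open>0 < u \<le> h\<close> satisfies \<open>\<bar>f - g\<bar> \<le> W\<close> and \<open>\<bar>g''\<bar> \<le> 12 W / h\<^sup>2\<close>, and the sharp
  Favard inequality \<open>E(g) \<le> sup \<bar>g''\<bar> / (32 n\<^sup>2)\<close> for degree \<open>n - 1\<close> yields the first bound. For
  the second one, replacing \<open>\<chi>\<^sub>u\<^sup>2\<close> by \<open>\<chi>\<^sub>u\<close> at most halves the deviation from \<open>f\<close>.

  Two integrations by parts write \<open>g\<close>, up to a constant, as the convolution of \<open>g''\<close> with the
  parabola \<open>(t - 1/2)\<^sup>2\<close>, so Favard's inequality reduces to approximating this parabola in
  \<open>L\<^sup>1[0,1]\<close> by cosine polynomials of degree less than \<open>n\<close>, with error \<open>1 / (16 n\<^sup>2)\<close>.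
  In the variable \<open>x = cos\<^sup>2(\<pi> t)\<close> the parabola is a power series with nonnegative coefficients.
  Interpolating such a function at the zeros of \<open>cos(2 \<pi> n t)\<close>, which are nonnegative in \<open>x\<close>, gives
  an error with the sign of \<open>cos(2 \<pi> n t)\<close>; since this sign function is orthogonal to the cosine
  polynomials of degree less than \<open>n\<close>, the error equals its integral against the parabola.
\<close>

section \<open>Division of polynomials with nonnegative coefficients\<close>

lemma poly_nonneg_coeffs:
  fixes p :: "real poly"
  assumes "\<And>k. coeff p k \<ge> 0" "x \<ge> 0"
  shows "poly p x \<ge> 0"
  unfolding poly_altdef using assms by (intro sum_nonneg) auto

text \<open>By Horner's scheme each coefficient of the quotient by \<open>x - a\<close> is the value
  at \<open>a\<close> of a tail of \<open>p\<close>, which is itself a polynomial with nonnegative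
  coefficients.\<close>

lemma synthetic_div_nonneg_coeffs:
  fixes p :: "real poly"
  assumes "\<And>k. coeff p k \<ge> 0" "a \<ge> 0"
  shows "coeff (synthetic_div p a) k \<ge> 0"
  using assms(1)
proof (induction p arbitrary: k)
  case 0
  then show ?case by simp
next
  case (pCons b q)
  have q: "coeff q j \<ge> 0" for j
    using pCons.prems[of "Suc j"] by simp
  show ?case
    using pCons.IH[OF q] poly_nonneg_coeffs[OF q \<open>a \<ge> 0\<close>]
    by (cases k) (auto simp: )
qed

text \<open>Newton interpolation: the factors are divided out one at a time, and each constant
  remainder \<open>poly q a\<close>, times the factors already removed, joins \<open>r\<close>. Thus
  \<open>r\<close> interpolates \<open>p\<close> at the points of \<open>A\<close>, and the error is
  the node polynomial times a \<open>q\<close> that is nonnegative on the half-line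
  \<open>x \<ge> 0\<close>.\<close>

lemma nonneg_quotient_by_linear_factors:
  fixes p :: "real poly"
  assumes "finite A" "\<And>a. a \<in> A \<Longrightarrow> a \<ge> 0" "\<And>k. coeff p k \<ge> 0"
  obtains q r where "p = (\<Prod>a\<in>A. [:-a, 1:]) * q + r" "\<And>k. coeff q k \<ge> 0"
    "\<And>k. card A \<le> k \<Longrightarrow> coeff r k = 0"
proof -
  have "\<exists>q r. p = (\<Prod>a\<in>A. [:-a, 1:]) * q + r \<and> (\<forall>k. coeff q k \<ge> 0) \<and>
          (\<forall>k\<ge>card A. coeff r k = 0)"
    using assms(1,2)
  proof (induction A)
    case empty
    show ?case using assms(3) by (intro exI[of _ p] exI[of _ 0]) auto
  next
    case (insert a A)
    then obtain q r where qr: "p = (\<Prod>a\<in>A. [:-a, 1:]) * q + r" "\<forall>k. coeff q k \<ge> 0"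
      "\<forall>k\<ge>card A. coeff r k = 0" by auto
    let ?P = "\<Prod>a\<in>A. [:-a, 1:]" and ?s = "synthetic_div q a"
    have q: "q = [:-a, 1:] * ?s + [:poly q a:]"
      using synthetic_div_correct'[of a q] by simp
    have "degree ?P \<le> card A"
      using degree_prod_sum_le[OF insert(1), of "\<lambda>a. [:-a, 1:]"] by simp
    then have deg: "coeff (?P * [:poly q a:]) k = 0" if "k \<ge> Suc (card A)" for k
      using that by (simp add: coeff_eq_0)
    show ?case
    proof (intro exI conjI)
      have "p = ?P * ([:-a, 1:] * ?s + [:poly q a:]) + r"
        using qr(1) q by metis
      also have "\<dots> = [:-a, 1:] * ?P * ?s + (?P * [:poly q a:] + r)"
        by (simp only: algebra_simps)
      finally show "p = (\<Prod>a\<in>insert a A. [:-a, 1:]) * ?s + (?P * [:poly q a:] + r)"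
        using insert(1,2) by simp
      show "\<forall>k. 0 \<le> coeff ?s k"
        using synthetic_div_nonneg_coeffs qr(2) insert.prems by simp
      show "\<forall>k\<ge>card (insert a A). coeff (?P * [:poly q a:] + r) k = 0"
        using deg qr(3) insert(1,2) by simp
    qed
  qed
  then show ?thesis using that by blast
qed

section \<open>Chebyshev polynomials in the variable $\cos^2(\pi t)$\<close>

text \<open>\<open>cheb n\<close> is \<open>T\<^sub>n(2 x - 1)\<close>, for \<open>T\<^sub>n\<close> the Chebyshev polynomial.\<close>

fun cheb :: "nat \<Rightarrow> real poly" where
  "cheb 0 = 1"
| "cheb (Suc 0) = [:-1, 2:]"
| "cheb (Suc (Suc k)) = [:-2, 4:] * cheb (Suc k) - cheb k"

lemma cos_squared_pi: "(cos (pi * t))\<^sup>2 = (1 + cos (2 * pi * t)) / 2" for t :: real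
  using cos_double_cos[of "pi * t"] by (simp add: mult.assoc)

text \<open>For \<open>x = (cos (pi * t))^2\<close> the factor \<open>[:-2, 4:]\<close> takes the
  value \<open>2 * cos (2 * pi * t)\<close>, which turns the recursion into the sum formula for
  cosines.\<close>

lemma poly_cheb: "poly (cheb n) ((cos (pi * t))\<^sup>2) = cos (2 * pi * n * t)"
proof (induction n rule: cheb.induct)
  case (3 k)
  have "cos (2 * pi * Suc (Suc k) * t) + cos (2 * pi * k * t)
        = 2 * cos (2 * pi * Suc k * t) * cos (2 * pi * t)"
    using cos_add[of "2 * pi * Suc k * t" "2 * pi * t"] cos_diff[of "2 * pi * Suc k * t" "2 * pi * t"]
    by (simp add: algebra_simps)
  then show ?case using 3 by (simp add: cos_squared_pi algebra_simps)
next
  case 2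
  have "2 * ((1 + cos (2 * pi * t)) / 2) - 1 = cos (2 * pi * t)"
    by (simp add: field_simps)
  then show ?case by (simp add: cos_squared_pi mult.commute)
qed simp

lemma degree_cheb: "degree (cheb n) = n \<and> lead_coeff (cheb n) > 0"
proof (induction n rule: cheb.induct)
  case (3 k)
  have d: "degree ([:-2, 4:] * cheb (Suc k)) = Suc (Suc k)"
    using 3 by (subst degree_mult_eq) auto
  have "degree (cheb (Suc (Suc k))) = Suc (Suc k)"
    using 3 d degree_add_eq_left[of "- cheb k" "[:-2, 4:] * cheb (Suc k)"] by simp
  moreover have "coeff (cheb (Suc (Suc k))) (Suc (Suc k)) = 4 * coeff (cheb (Suc k)) (Suc k)"
    using 3 by (simp add: coeff_eq_0)
  ultimately show ?case using 3 by auto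
qed auto

text \<open>The zeros of \<open>cos (2 * pi * n * t)\<close> in the half period
  \<open>0 < t < 1/2\<close>, carried over to the variable \<open>x\<close>.\<close>

definition cheb_nodes :: "nat \<Rightarrow> real set" where
  "cheb_nodes n = (\<lambda>k. (cos (pi * ((2 * real k + 1) / (4 * real n))))\<^sup>2) ` {..<n}"

lemma card_cheb_nodes: "card (cheb_nodes n) = n"
proof -
  \<comment> \<open>The angles lie between 0 and \<open>pi / 2\<close>, where cosine is both
    nonnegative and injective, so squaring merges no two nodes.\<close>
  have "inj_on (\<lambda>k. (cos (pi * ((2 * real k + 1) / (4 * real n))))\<^sup>2) {..<n}"
  proof (rule inj_onI, goal_cases)
    case (1 i j)
    let ?t = "\<lambda>k. pi * ((2 * real k + 1) / (4 * real n))"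
    have r: "0 \<le> ?t k" "?t k \<le> pi / 2" if "k < n" for k
    proof -
      have "2 * real k + 1 \<le> 2 * real n" using that by linarith
      then have "(2 * real k + 1) / (4 * real n) \<le> 1 / 2"
        using that by (simp add: field_simps)
      then have "?t k \<le> pi * (1 / 2)"
        by (intro mult_left_mono) auto
      then show "0 \<le> ?t k" "?t k \<le> pi / 2"
        by auto
    qed
    have "0 \<le> cos (?t k)" if "k < n" for k
      using r[OF that] pi_ge_zero by (intro cos_ge_zero) linarith+
    then have "cos (?t i) = cos (?t j)"
      using 1 power2_eq_iff_nonneg[of "cos (?t i)" "cos (?t j)"] by blast
    moreover have "?t k \<le> pi" if "k < n" for k
      using r[OF that] pi_ge_zero by linarith
    moreover have "i < n" "j < n" using 1 by simp_all
    ultimately have "?t i = ?t j"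
      using cos_inj_pi[OF r(1) _ r(1), of i j] by metis
    then have "(2 * real i + 1) / (4 * real n) = (2 * real j + 1) / (4 * real n)"
      by (metis pi_neq_zero mult_left_cancel)
    moreover from \<open>i \<in> {..<n}\<close> have "4 * real n \<noteq> 0" by (cases n) simp_all
    ultimately have "2 * real i + 1 = 2 * real j + 1" by (metis divide_cancel_right)
    then show ?case by linarith
  qed
  then show ?thesis by (simp add: cheb_nodes_def card_image)
qed

lemma cheb_nodes_root:
  assumes "a \<in> cheb_nodes n"
  shows "poly (cheb n) a = 0"
proof -
  obtain k where k: "k < n" "a = (cos (pi * ((2 * real k + 1) / (4 * real n))))\<^sup>2"
    using assms by (auto simp: cheb_nodes_def)
  have "2 * pi * n * ((2 * real k + 1) / (4 * real n)) = real (2 * k + 1) * (pi / 2)"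
    using k(1) by (simp add: field_simps)
  then show ?thesis
    unfolding k(2) poly_cheb cos_zero_iff by (intro disjI1 exI[of _ "2 * k + 1"]) simp
qed

text \<open>Both sides have degree \<open>n\<close>, the same leading coefficient and
  \<open>n\<close> common zeros. As the leading coefficient is positive, the node polynomial has the
  sign of \<open>cos (2 * pi * n * t)\<close>.\<close>

lemma cheb_factor:
  "cheb n = smult (lead_coeff (cheb n)) (\<Prod>a\<in>cheb_nodes n. [:-a, 1:])"
proof -
  have "finite (cheb_nodes n)" by (simp add: cheb_nodes_def)
  moreover have "degree (\<Prod>a\<in>cheb_nodes n. [:-a, 1:]) = n"
     by (subst degree_prod_eq_sum_degree) (auto simp: card_cheb_nodes)
  moreover have "lead_coeff (\<Prod>a\<in>cheb_nodes n. [:-a, 1:]) = 1"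
     by (simp add: lead_coeff_prod)
  ultimately show ?thesis
    using degree_cheb[of n] card_cheb_nodes[of n] cheb_nodes_root[of _ n]
    by (intro poly_eqI_degree_lead_coeff[of _ n _ "cheb_nodes n"]) (auto simp: poly_prod)
qed

section \<open>The parabola as a power series in $\cos^2(\pi t)$\<close>

text \<open>The coefficients of \<open>4 arcsin\<^sup>2(\<surd>x)\<close>; their recursion is the differential equation
  \<open>x (1 - x) F'' + (1/2 - x) F' = 2\<close> of this function.\<close>

fun asq_coeff :: "nat \<Rightarrow> real" where
  "asq_coeff 0 = 0"
| "asq_coeff (Suc 0) = 4"
| "asq_coeff (Suc (Suc k)) = (Suc k)\<^sup>2 / ((k + 2) * (k + 3 / 2)) * asq_coeff (Suc k)"

lemma asq_coeff_bounds: "0 \<le> asq_coeff k \<and> asq_coeff k \<le> 4"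
proof (induction k rule: asq_coeff.induct)
  case (3 k)
  have "(real (Suc k))\<^sup>2 \<le> (k + 2) * (k + 3 / 2)"
    by (simp add: field_simps power2_eq_square)
  moreover have "(k + 2) * (real k + 3 / 2) > 0"
    by (intro mult_pos_pos) auto
  ultimately have "(real (Suc k))\<^sup>2 / ((k + 2) * (k + 3 / 2)) \<le> 1"
    by (simp only: divide_le_eq_1_pos)
  then have "(real (Suc k))\<^sup>2 / ((k + 2) * (k + 3 / 2)) * asq_coeff (Suc k) \<le> 1 * 4"
    using 3 by (intro mult_mono) auto
  then show ?case using 3 by (auto simp: add_ac)
qed auto

definition asq :: "real \<Rightarrow> real" where
  "asq x = (\<Sum>k. asq_coeff k * x ^ k)"

lemma summable_asq: "summable (\<lambda>k. asq_coeff k * x ^ k)" if "norm x < 1"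
proof (rule summable_comparison_test')
  show "summable (\<lambda>k. 4 * norm x ^ k)"
    using that by (intro summable_mult summable_geometric) auto
  show "norm (asq_coeff k * x ^ k) \<le> 4 * norm x ^ k" for k
    using asq_coeff_bounds[of k]
    by (simp add: abs_mult power_abs mult_right_mono)
qed

lemma asq_ode:
  obtains F' F'' where
    "\<And>x. norm x < 1 \<Longrightarrow> (asq has_real_derivative F' x) (at x)"
    "\<And>x. norm x < 1 \<Longrightarrow> (F' has_real_derivative F'' x) (at x)"
    "\<And>x. norm x < 1 \<Longrightarrow> x * (1 - x) * F'' x + (1 / 2 - x) * F' x = 2"
proof -
  define d where "d = diffs asq_coeff"
  define F' where "F' = (\<lambda>x. \<Sum>k. d k * x ^ k)"
  define F'' where "F'' = (\<lambda>x. \<Sum>k. diffs d k * x ^ k)"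
  have d: "summable (\<lambda>k. d k * x ^ k)" if "norm x < 1" for x
    unfolding d_def using that summable_asq by (rule termdiff_converges)
  have dd: "summable (\<lambda>k. diffs d k * x ^ k)" if "norm x < 1" for x
    using that d by (rule termdiff_converges)
  \<comment> \<open>The differential equation read coefficientwise, in the form
    \<open>x F'' + F'/2 = x (x F'' + F') + 2\<close>; the case \<open>k = 0\<close> carries the
    constant 2.\<close>
  have rec: "(real k + 1 / 2) * d k = (if k = 0 then 2 else k * d (k - 1))" for k
  proof (cases k)
    case (Suc j)
    have "real j + 2 \<noteq> 0" "real j + 3 / 2 \<noteq> 0" by auto
    then have "(real j + 3 / 2) * ((j + 2) * (x / ((j + 2) * (j + 3 / 2)) * y)) = x * y" for x y :: real
      by simp
    from this[of "(Suc j)\<^sup>2" "asq_coeff (Suc j)"]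
    have "(real j + 3 / 2) * ((j + 2) * asq_coeff (Suc (Suc j))) = (Suc j)\<^sup>2 * asq_coeff (Suc j)"
      by (simp add: add_ac)
    moreover have "real (Suc j) + 1 / 2 = real j + 3 / 2" "real (Suc (Suc j)) = real (j + 2)" by simp_all
    ultimately show ?thesis
      using Suc by (simp only: d_def diffs_def power2_eq_square) (simp add: mult.assoc, simp add: algebra_simps)
  qed (auto simp: d_def diffs_def)
  show thesis
  proof (rule that)
    fix x :: real assume x: "norm x < 1"
    show "(asq has_real_derivative F' x) (at x)"
      unfolding asq_def[abs_def] F'_def d_def by (rule termdiffs_strong'[OF summable_asq x])
    show "(F' has_real_derivative F'' x) (at x)"
      unfolding F'_def F''_def by (rule termdiffs_strong'[OF d x])
    have sd: "(\<lambda>k. d k * x ^ k) sums F' x"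
      unfolding F'_def by (rule summable_sums[OF d[OF x]])
    have "(\<lambda>k. x * (diffs d k * x ^ k)) sums (x * F'' x)"
      unfolding F''_def by (rule sums_mult[OF summable_sums[OF dd[OF x]]])
    then have "(\<lambda>k. real (Suc k) * d (Suc k) * x ^ Suc k) sums (x * F'' x)"
      by (simp add: diffs_def algebra_simps)
    then have xF: "(\<lambda>k. real k * d k * x ^ k) sums (x * F'' x)"
      by (subst (asm) sums_Suc_iff) simp
    from sums_mult[OF sums_add[OF xF sd], of x]
    have "(\<lambda>k. real (Suc k) * d k * x ^ Suc k) sums (x * (x * F'' x + F' x))"
      by (simp add: algebra_simps)
    \<comment> \<open>At \<open>k = 0\<close> the truncated index \<open>k - 1\<close> is harmless
      because of the factor \<open>real k\<close>.\<close>
    then have R: "(\<lambda>k. real k * d (k - 1) * x ^ k) sums (x * (x * F'' x + F' x))"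
      using sums_Suc_iff[of "\<lambda>k. real k * d (k - 1) * x ^ k"] by simp
    have "(\<lambda>k. (if k = 0 then 2 else 0 :: real)) sums 2"
      using sums_single[of 0 "\<lambda>_. 2 :: real"] by simp
    from sums_add[OF R this]
    have "(\<lambda>k. (real k + 1 / 2) * d k * x ^ k) sums (x * (x * F'' x + F' x) + 2)"
      unfolding rec by (rule back_subst[of "\<lambda>f. f sums _"]) (auto simp: fun_eq_iff)
    moreover from sums_add[OF xF sums_mult[OF sd, of "1/2"]]
    have "(\<lambda>k. (real k + 1 / 2) * d k * x ^ k) sums (x * F'' x + 1 / 2 * F' x)"
      by (simp add: algebra_simps)
    ultimately have "x * F'' x + 1 / 2 * F' x = x * (x * F'' x + F' x) + 2"
      using sums_unique2 by blast
    then show "x * (1 - x) * F'' x + (1 / 2 - x) * F' x = 2"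
      by (simp add: algebra_simps)
  qed
qed

lemma cos_squared_pi_less_1:
  assumes "0 < t" "t < 1"
  shows "(cos (pi * t))\<^sup>2 < 1"
proof -
  have "sin (pi * t) > 0"
    using assms by (intro sin_gt_zero) auto
  then have "(sin (pi * t))\<^sup>2 > 0" by simp
  then show ?thesis using sin_cos_squared_add[of "pi * t"] by linarith
qed

text \<open>With \<open>x = (cos (pi * t))^2\<close> the chain rule turns the second derivative in
  \<open>t\<close> of \<open>asq x\<close> into \<open>4 pi^2\<close> times the left side of the
  differential equation, hence into the constant \<open>8 pi^2\<close>. The two integration
  constants are fixed at \<open>t = 1/2\<close>, where \<open>x\<close>, \<open>asq x\<close> and
  \<open>sin (2 * pi * t)\<close> all vanish.\<close>

lemma asq_cos_squared:
  assumes t: "0 < t" "t < 1"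
  shows "asq ((cos (pi * t))\<^sup>2) = 4 * pi\<^sup>2 * (t - 1 / 2)\<^sup>2"
proof -
  obtain F' F'' where F:
    "\<And>x. norm x < 1 \<Longrightarrow> (asq has_real_derivative F' x) (at x)"
    "\<And>x. norm x < 1 \<Longrightarrow> (F' has_real_derivative F'' x) (at x)"
    "\<And>x. norm x < 1 \<Longrightarrow> x * (1 - x) * F'' x + (1 / 2 - x) * F' x = 2"
    by (rule asq_ode) blast
  let ?x = "\<lambda>t. (cos (pi * t))\<^sup>2"
  have n: "norm (?x s) < 1" if "s \<in> {0<..<1}" for s
    using cos_squared_pi_less_1[of s] that by simp
  have x': "(?x has_real_derivative - pi * sin (2 * pi * s)) (at s)" for s
    unfolding cos_squared_pi by (auto intro!: derivative_eq_intros)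
  have P1: "((\<lambda>s. asq (?x s)) has_real_derivative F' (?x s) * (- pi * sin (2 * pi * s))) (at s)"
    if "s \<in> {0<..<1}" for s
    by (rule DERIV_chain2[OF F(1)[OF n[OF that]] x'])
  have P2: "((\<lambda>s. F' (?x s) * (- pi * sin (2 * pi * s))) has_real_derivative 8 * pi\<^sup>2) (at s)"
    if "s \<in> {0<..<1}" for s
  proof -
    have "((\<lambda>s. F' (?x s) * (- pi * sin (2 * pi * s))) has_real_derivative
        F'' (?x s) * (- pi * sin (2 * pi * s)) * (- pi * sin (2 * pi * s))
        + (- 2 * pi\<^sup>2 * cos (2 * pi * s)) * F' (?x s)) (at s)"
      by (rule DERIV_mult DERIV_chain2[OF F(2)[OF n[OF that]] x'] |
          (auto intro!: derivative_eq_intros simp: power2_eq_square; fail))+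
    also have "F'' (?x s) * (- pi * sin (2 * pi * s)) * (- pi * sin (2 * pi * s))
       = pi\<^sup>2 * F'' (?x s) * (sin (2 * pi * s))\<^sup>2"
      by (simp add: power2_eq_square)
    also have "(sin (2 * pi * s))\<^sup>2 = 4 * (?x s * (1 - ?x s))"
      unfolding cos_squared_pi sin_squared_eq by (simp add: field_simps power2_eq_square)
    also have "cos (2 * pi * s) = 2 * ?x s - 1"
      unfolding cos_squared_pi by (simp add: field_simps)
    also have "pi\<^sup>2 * F'' (?x s) * (4 * (?x s * (1 - ?x s))) + - 2 * pi\<^sup>2 * (2 * ?x s - 1) * F' (?x s)
       = 4 * pi\<^sup>2 * (?x s * (1 - ?x s) * F'' (?x s) + (1 / 2 - ?x s) * F' (?x s))"
      by (simp add: algebra_simps)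
    also note F(3)[OF n[OF that]]
    finally show ?thesis by simp
  qed
  have half: "?x (1 / 2) = 0" "sin (2 * pi * (1 / 2)) = 0" by auto
  have Q: "F' (?x s) * (- pi * sin (2 * pi * s)) = 8 * pi\<^sup>2 * (s - 1 / 2)" if "s \<in> {0<..<1}" for s
  proof -
    have "((\<lambda>s. F' (?x s) * (- pi * sin (2 * pi * s)) - 8 * pi\<^sup>2 * (s - 1 / 2))
        has_real_derivative 0) (at s)" if "s \<in> {0<..<1}" for s
      by (rule derivative_eq_intros P2[OF that] refl)+ simp
    then have "\<exists>c. \<forall>s\<in>{0<..<1}. F' (?x s) * (- pi * sin (2 * pi * s)) - 8 * pi\<^sup>2 * (s - 1 / 2) = c"
      by (intro has_field_derivative_zero_constant)
         (auto intro: has_field_derivative_at_within)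
    then obtain c where c: "F' (?x s) * (- pi * sin (2 * pi * s)) - 8 * pi\<^sup>2 * (s - 1 / 2) = c"
      if "s \<in> {0<..<1}" for s by auto
    from c[of "1/2"] half have "c = 0" by auto
    then show ?thesis using c[OF that] by simp
  qed
  have "((\<lambda>s. asq (?x s) - 4 * pi\<^sup>2 * (s - 1 / 2)\<^sup>2) has_real_derivative 0) (at s)"
    if "s \<in> {0<..<1}" for s
  proof -
    have "((\<lambda>s. asq (?x s) - 4 * pi\<^sup>2 * (s - 1 / 2)\<^sup>2) has_real_derivative
        F' (?x s) * (- pi * sin (2 * pi * s)) - 8 * pi\<^sup>2 * (s - 1 / 2)) (at s)"
      by (rule derivative_eq_intros P1[OF that] refl)+ simp
    then show ?thesis unfolding Q[OF that] by simp
  qed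
  then have "\<exists>c. \<forall>s\<in>{0<..<1}. asq (?x s) - 4 * pi\<^sup>2 * (s - 1 / 2)\<^sup>2 = c"
    by (intro has_field_derivative_zero_constant)
       (auto intro: has_field_derivative_at_within)
  then obtain c where c: "asq (?x s) - 4 * pi\<^sup>2 * (s - 1 / 2)\<^sup>2 = c" if "s \<in> {0<..<1}" for s
    by auto
  have "asq 0 = 0" by (simp add: asq_def powser_zero)
  with c[of "1/2"] half have "c = 0" by auto
  then show ?thesis using c[of t] t by simp
qed

section \<open>Integrability of bounded functions and integrals over one period\<close>

lemma bounded_borel_integrable_on:
  fixes f :: "real \<Rightarrow> real"
  assumes [measurable]: "f \<in> borel_measurable borel" and "\<And>x. \<bar>f x\<bar> \<le> K"
  shows "f integrable_on {a..b}"
proof -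
  have "set_integrable lborel {a..b} f"
    unfolding set_integrable_def
    by (rule integrableI_bounded_set[where A = "{a..b}" and B = K])
       (auto simp: assms(2) emeasure_lborel_Icc_eq)
  then show ?thesis by (rule set_borel_integral_eq_integral)
qed

lemma periodic_of_int:
  fixes p :: "real \<Rightarrow> 'a"
  assumes "\<And>t. p (t + 1) = p t"
  shows "p (t + of_int k) = p t"
proof (induction k rule: int_induct[where k = 0])
  case (step1 i)
  then show ?case using assms[of "t + of_int i"] by (simp add: add_ac)
next
  case (step2 i)
  then show ?case using assms[of "t + of_int (i - 1)"] by (simp add: algebra_simps)
qed simp

text \<open>Only the fractional part \<open>y\<close> of the shift matters; the piece of the
  integral over \<open>{1..1 + y}\<close> is moved back by one period.\<close>

lemma integral_periodic_shift:
  fixes p :: "real \<Rightarrow> real"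
  assumes int: "\<And>a b. p integrable_on {a..b}" and per: "\<And>t. p (t + 1) = p t"
  shows "integral {0..1} (\<lambda>t. p (x + t)) = integral {0..1} p"
proof -
  define y where "y = frac x"
  have y: "0 \<le> y" "y \<le> 1" unfolding y_def using frac_lt_1[of x] by auto
  have "p (x + t) = p (t + y)" for t
    using periodic_of_int[of p "t + y" "\<lfloor>x\<rfloor>", OF per] by (simp add: y_def frac_def algebra_simps)
  then have "integral {0..1} (\<lambda>t. p (x + t)) = integral {0..1} (\<lambda>t. p (t + y))"
    by simp
  also have "\<dots> = integral {y..1 + y} p"
    using integral_shift_real_ivl[where a = y and b = "1 + y" and c = y and f = p] by simp
  also have "\<dots> = integral {y..1} p + integral {1..1 + y} p"
    using y int by (intro Henstock_Kurzweil_Integration.integral_combine[symmetric]) auto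
  also have "integral {1..1 + y} p = integral {0..y} (\<lambda>t. p (t + 1))"
    using integral_shift_real_ivl[where a = 1 and b = "1 + y" and c = 1 and f = p] by simp
  also have "\<dots> = integral {0..y} p" by (simp add: per)
  also have "integral {y..1} p + integral {0..y} p = integral {0..1} p"
    using y int by (subst add.commute, intro Henstock_Kurzweil_Integration.integral_combine) auto
  finally show ?thesis .
qed

section \<open>The sign of $\cos(2 \pi n t)$\<close>

definition sgn_cos :: "nat \<Rightarrow> real \<Rightarrow> real" where
  "sgn_cos n t = sgn (cos (2 * pi * n * t))"

lemma sgn_cos_borel [measurable]: "sgn_cos n \<in> borel_measurable borel"
  unfolding sgn_cos_def[abs_def] by measurable

lemma abs_sgn_cos_le_1: "\<bar>sgn_cos n t\<bar> \<le> 1"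
  unfolding sgn_cos_def by (simp add: abs_sgn_eq)

lemma sgn_cos_shift: "sgn_cos n (t + real k / n) = sgn_cos n t" if "n \<ge> 1"
proof -
  have "2 * pi * n * (t + real k / n) = 2 * pi * n * t + 2 * of_nat k * pi"
    using that by (simp add: field_simps)
  then show ?thesis unfolding sgn_cos_def by (simp only: cos_add) simp
qed

lemma sgn_cos_antiperiodic:
  assumes "n \<ge> 1"
  shows "sgn_cos n (1 / (2 * real n) + t) = - sgn_cos n t"
    and "sgn_cos n (- (1 / (2 * real n)) + t) = - sgn_cos n t"
proof -
  have "2 * pi * n * (1 / (2 * real n) + t) = 2 * pi * n * t + pi"
    "2 * pi * n * (- (1 / (2 * real n)) + t) = 2 * pi * n * t - pi"
    using assms by (simp_all add: field_simps)
  then show "sgn_cos n (1 / (2 * real n) + t) = - sgn_cos n t"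
    "sgn_cos n (- (1 / (2 * real n)) + t) = - sgn_cos n t"
    unfolding sgn_cos_def by (simp_all add: sgn_minus)
qed

lemma sgn_cos_integrable_on:
  assumes "continuous_on UNIV q" "\<And>t. \<bar>q t\<bar> \<le> K"
  shows "(\<lambda>t. sgn_cos n t * q t) integrable_on {a..b}"
proof (rule bounded_borel_integrable_on)
  have [measurable]: "q \<in> borel_measurable borel"
    using assms(1) by (rule borel_measurable_continuous_onI)
  show "(\<lambda>t. sgn_cos n t * q t) \<in> borel_measurable borel" by measurable
  show "\<bar>sgn_cos n t * q t\<bar> \<le> 1 * K" for t
    unfolding abs_mult by (intro mult_mono abs_sgn_cos_le_1 assms) auto
qed

text \<open>Shifting by \<open>1 / (2 n)\<close> in either direction flips the sign function, while
  the two shifted cosines add up to \<open>2 cos (pi j / n)\<close> times the original one. Hence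
  \<open>2 I = - 2 cos (pi j / n) I\<close>, and \<open>j < n\<close> keeps this cosine above
  -1.\<close>

lemma integral_sgn_cos_orthogonal:
  assumes "j < n"
  shows "integral {0..1} (\<lambda>t. sgn_cos n t * cos (2 * pi * j * t)) = 0"
proof -
  have n: "n \<ge> 1" using assms by simp
  let ?p = "\<lambda>t. sgn_cos n t * cos (2 * pi * j * t)"
  define I where "I = integral {0..1} ?p"
  define d where "d = 1 / (2 * real n)"
  have int: "?p integrable_on {a..b}" for a b
    by (rule sgn_cos_integrable_on[where K = 1]) (auto intro!: continuous_intros)
  have per: "?p (t + 1) = ?p t" for t
  proof -
    have "2 * pi * j * (t + 1) = 2 * pi * j * t + 2 * of_nat j * pi"
      by (simp add: algebra_simps)
    then show ?thesis
      using sgn_cos_shift[OF n, of t n] n by (simp only: cos_add) simp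
  qed
  have sh: "integral {0..1} (\<lambda>t. ?p (x + t)) = I" for x
    unfolding I_def by (rule integral_periodic_shift[OF int per])
  have intx: "(\<lambda>t. ?p (x + t)) integrable_on {0..1}" for x
    using integrable_shift_real_ivl[OF int[of x "1 + x"], of x] by (simp add: add.commute)
  have "I + I = integral {0..1} (\<lambda>t. ?p (d + t)) + integral {0..1} (\<lambda>t. ?p (- d + t))"
    by (simp only: sh)
  also have "\<dots> = integral {0..1} (\<lambda>t. ?p (d + t) + ?p (- d + t))"
    by (rule Henstock_Kurzweil_Integration.integral_add[symmetric]) (rule intx)+
  also have "(\<lambda>t. ?p (d + t) + ?p (- d + t)) = (\<lambda>t. - 2 * cos (2 * pi * j * d) * ?p t)"
  proof
    fix t
    have "?p (d + t) + ?p (- d + t)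
        = - sgn_cos n t * (cos (2 * pi * j * t + 2 * pi * j * d) + cos (2 * pi * j * t - 2 * pi * j * d))"
      unfolding d_def sgn_cos_antiperiodic[OF n] by (simp add: algebra_simps)
    also have "\<dots> = - 2 * cos (2 * pi * j * d) * ?p t"
      unfolding cos_add cos_diff by (simp add: algebra_simps)
    finally show "?p (d + t) + ?p (- d + t) = - 2 * cos (2 * pi * j * d) * ?p t" .
  qed
  also have "integral {0..1} \<dots> = - 2 * cos (2 * pi * j * d) * I"
    unfolding I_def by simp
  finally have "1 * I + cos (2 * pi * j * d) * I = 0" by linarith
  then have "(1 + cos (2 * pi * j * d)) * I = 0" unfolding distrib_right .
  moreover have "cos pi < cos (2 * pi * j * d)"
    using assms by (intro cos_monotone_0_pi) (auto simp: d_def field_simps)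
  ultimately have "I = 0" unfolding mult_eq_0_iff cos_pi by linarith
  then show ?thesis unfolding I_def .
qed

lemma sgn_cos_values:
  assumes "n \<ge> 1"
  shows "0 < t \<Longrightarrow> t < 1 / (4 * n) \<Longrightarrow> sgn_cos n t = 1"
    and "1 / (4 * n) < t \<Longrightarrow> t < 3 / (4 * n) \<Longrightarrow> sgn_cos n t = - 1"
    and "3 / (4 * n) < t \<Longrightarrow> t < 1 / n \<Longrightarrow> sgn_cos n t = 1"
proof -
  \<comment> \<open>In the variable \<open>w\<close> the sign changes occur at odd integers; shifts
    by 2 and 4 bring each case back to the interval from -1 to 1, where the cosine is
    positive.\<close>
  define w where "w = 4 * real n * t"
  have e: "2 * pi * n * t = pi / 2 * w" "cos (pi / 2 * w) = - cos (pi / 2 * (w - 2))"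
    "cos (pi / 2 * w) = cos (pi / 2 * (w - 4))"
    unfolding w_def by (simp_all add: algebra_simps cos_diff)
  have pos: "cos (pi / 2 * v) > 0" if "-1 < v" "v < 1" for v
  proof (rule cos_gt_zero_pi)
    show "- (pi / 2) < pi / 2 * v" "pi / 2 * v < pi / 2"
      using mult_strict_left_mono[OF that(1), of "pi / 2"] mult_strict_left_mono[OF that(2), of "pi / 2"]
      by auto
  qed
  { assume "0 < t" "t < 1 / (4 * n)"
    then have "-1 < w" "w < 1" using assms by (auto simp: w_def field_simps intro: less_trans[of _ 0])
    then have "cos (pi / 2 * w) > 0" using pos[of w] by linarith
    then show "sgn_cos n t = 1" unfolding sgn_cos_def e(1) by (rule sgn_pos) }
  { assume "1 / (4 * n) < t" "t < 3 / (4 * n)"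
    then have "1 < w" "w < 3" using assms by (auto simp: w_def field_simps)
    then have "cos (pi / 2 * w) < 0" unfolding e(2) using pos[of "w - 2"] by linarith
    then show "sgn_cos n t = - 1" unfolding sgn_cos_def e(1) by (rule sgn_neg) }
  { assume "3 / (4 * n) < t" "t < 1 / n"
    then have "3 < w" "w < 4" using assms by (auto simp: w_def field_simps)
    then have "cos (pi / 2 * w) > 0" unfolding e(3) using pos[of "w - 4"] by linarith
    then show "sgn_cos n t = 1" unfolding sgn_cos_def e(1) by (rule sgn_pos) }
qed

text \<open>On each cell of length \<open>L = 1 / n\<close> the sign pattern is +, -, + with breaks
  at \<open>L / 4\<close> and \<open>3 L / 4\<close>. It annihilates affine functions, so the
  position of the cell relative to the vertex does not matter: each of the \<open>n\<close> cells
  contributes \<open>L^3 / 16\<close>.\<close>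

lemma integral_sgn_cos_parabola:
  assumes "n \<ge> 1"
  shows "((\<lambda>t. sgn_cos n t * (t - 1 / 2)\<^sup>2) has_integral 1 / (16 * (real n)\<^sup>2)) {0..1}"
proof -
  define L where "L = 1 / real n"
  have L: "L > 0" using assms by (simp add: L_def)
  let ?q = "\<lambda>t. sgn_cos n t * (t - 1 / 2)\<^sup>2"
  have piece: "(?q has_integral s * ((b - 1 / 2) ^ 3 / 3 - (a - 1 / 2) ^ 3 / 3)) {a..b}"
    if "a \<le> b" "\<And>t. t \<in> {a<..<b} \<Longrightarrow> sgn_cos n t = s" for a b s
  proof -
    have "((\<lambda>t. (t - 1 / 2)\<^sup>2) has_integral ((b - 1 / 2) ^ 3 / 3 - (a - 1 / 2) ^ 3 / 3)) {a..b}"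
      using that(1)
      by (intro fundamental_theorem_of_calculus)
         (auto intro!: derivative_eq_intros simp: has_real_derivative_iff_has_vector_derivative[symmetric])
    then have "((\<lambda>t. s * (t - 1 / 2)\<^sup>2) has_integral s * ((b - 1 / 2) ^ 3 / 3 - (a - 1 / 2) ^ 3 / 3)) (cbox a b)"
      by (simp add: has_integral_mult_right)
    then have "(?q has_integral s * ((b - 1 / 2) ^ 3 / 3 - (a - 1 / 2) ^ 3 / 3)) (cbox a b)"
      by (rule has_integral_spike_interior) (use that(2) in auto)
    then show ?thesis by simp
  qed
  have cell: "(?q has_integral L ^ 3 / 16) {k * L..Suc k * L}" for k
  proof -
    have s: "sgn_cos n t = sgn_cos n (t - k * L)" for t
      using sgn_cos_shift[OF assms, of "t - k * L" k] by (simp add: L_def)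
    let ?a = "k * L"
    have v: "t \<in> {?a<..<?a + L / 4} \<Longrightarrow> sgn_cos n t = 1"
      "t \<in> {?a + L / 4<..<?a + 3 * L / 4} \<Longrightarrow> sgn_cos n t = - 1"
      "t \<in> {?a + 3 * L / 4<..<?a + L} \<Longrightarrow> sgn_cos n t = 1" for t
      using sgn_cos_values[OF assms, of "t - ?a"] s[of t] by (auto simp: L_def)
    have "(?q has_integral 1 * ((?a + L / 4 - 1 / 2) ^ 3 / 3 - (?a - 1 / 2) ^ 3 / 3)) {?a..?a + L / 4}"
      using L v(1) by (intro piece) auto
    moreover have "(?q has_integral (- 1) * ((?a + 3 * L / 4 - 1 / 2) ^ 3 / 3 - (?a + L / 4 - 1 / 2) ^ 3 / 3))
        {?a + L / 4..?a + 3 * L / 4}"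
      using L v(2) by (intro piece) auto
    moreover have "(?q has_integral 1 * ((?a + L - 1 / 2) ^ 3 / 3 - (?a + 3 * L / 4 - 1 / 2) ^ 3 / 3))
        {?a + 3 * L / 4..?a + L}"
      using L v(3) by (intro piece) auto
    ultimately have h: "(?q has_integral 1 * ((?a + L / 4 - 1 / 2) ^ 3 / 3 - (?a - 1 / 2) ^ 3 / 3)
        + (- 1) * ((?a + 3 * L / 4 - 1 / 2) ^ 3 / 3 - (?a + L / 4 - 1 / 2) ^ 3 / 3)
        + 1 * ((?a + L - 1 / 2) ^ 3 / 3 - (?a + 3 * L / 4 - 1 / 2) ^ 3 / 3)) {?a..?a + L}"
      using L by (intro has_integral_combine[of ?a "?a + 3 * L / 4" "?a + L"]
          has_integral_combine[of ?a "?a + L / 4" "?a + 3 * L / 4"]) auto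
    have e: "1 * ((a + L / 4 - 1 / 2) ^ 3 / 3 - (a - 1 / 2) ^ 3 / 3)
        + (- 1) * ((a + 3 * L / 4 - 1 / 2) ^ 3 / 3 - (a + L / 4 - 1 / 2) ^ 3 / 3)
        + 1 * ((a + L - 1 / 2) ^ 3 / 3 - (a + 3 * L / 4 - 1 / 2) ^ 3 / 3) = L ^ 3 / 16" for a
      by (simp add: power3_eq_cube field_simps)
    have i: "?a + L = Suc k * L" by (simp add: algebra_simps)
    show ?thesis using h unfolding e unfolding i .
  qed
  have "(?q has_integral k * (L ^ 3 / 16)) {0..k * L}" for k :: nat
  proof (induction k)
    case (Suc k)
    have "(?q has_integral k * (L ^ 3 / 16) + L ^ 3 / 16) {0..Suc k * L}"
      using L by (intro has_integral_combine[OF _ _ Suc cell]) auto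
    moreover have "k * (L ^ 3 / 16) + L ^ 3 / 16 = Suc k * (L ^ 3 / 16)"
      by (simp add: add_divide_distrib distrib_right)
    ultimately show ?case by (simp only:)
  qed (simp_all add: has_integral_refl)
  from this[of n] have "(?q has_integral n * (L ^ 3 / 16)) {0..1}"
    using assms by (simp add: L_def)
  moreover have "n * (L ^ 3 / 16) = 1 / (16 * (real n)\<^sup>2)"
    using assms by (simp add: L_def power2_eq_square power3_eq_cube)
  ultimately show ?thesis by (simp only:)
qed

section \<open>Approximation of the parabola in the mean\<close>

definition cos_sums :: "nat \<Rightarrow> (real \<Rightarrow> real) set" where
  "cos_sums m = {F. \<exists>b. \<forall>t. F t = (\<Sum>j\<le>m. b j * cos (2 * pi * real j * t))}"

lemma cos_sums_cos: "(\<lambda>t. c * cos (2 * pi * real j * t)) \<in> cos_sums m" if "j \<le> m"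
  unfolding cos_sums_def mem_Collect_eq
  by (rule exI[of _ "\<lambda>i. if i = j then c else 0"])
     (use that in \<open>simp add: if_distrib[of "\<lambda>u. u * _"] cong: if_cong\<close>)

lemma cos_sums_add:
  assumes "F \<in> cos_sums m" "G \<in> cos_sums m"
  shows "(\<lambda>t. F t + G t) \<in> cos_sums m"
proof -
  obtain b d where "\<And>t. F t = (\<Sum>j\<le>m. b j * cos (2 * pi * real j * t))"
    "\<And>t. G t = (\<Sum>j\<le>m. d j * cos (2 * pi * real j * t))"
    using assms by (auto simp: cos_sums_def)
  then have "\<forall>t. F t + G t = (\<Sum>j\<le>m. (b j + d j) * cos (2 * pi * real j * t))"
    by (simp add: distrib_right sum.distrib)
  then show ?thesis unfolding cos_sums_def by (intro CollectI exI)
qed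

lemma cos_sums_sum:
  assumes "\<And>i. i \<in> I \<Longrightarrow> F i \<in> cos_sums m"
  shows "(\<lambda>t. \<Sum>i\<in>I. F i t) \<in> cos_sums m"
  using assms
proof (induction I rule: infinite_finite_induct)
  case (insert i I)
  then show ?case using cos_sums_add[of "F i" m "\<lambda>t. \<Sum>i\<in>I. F i t"] by simp
qed (use cos_sums_cos[of 0 m 0] in simp_all)

lemma cos_sums_mult_x:
  assumes "F \<in> cos_sums m"
  shows "(\<lambda>t. (cos (pi * t))\<^sup>2 * F t) \<in> cos_sums (Suc m)"
proof -
  obtain b where b: "\<And>t. F t = (\<Sum>j\<le>m. b j * cos (2 * pi * real j * t))"
    using assms by (auto simp: cos_sums_def)
  \<comment> \<open>Product formula for cosines. For \<open>j = 0\<close> the lower frequency would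
    be -1; since cosine is even, it is replaced by 1.\<close>
  have "(cos (pi * t))\<^sup>2 * F t =
    (\<Sum>j\<le>m. b j / 2 * cos (2 * pi * real j * t) + (b j / 4 * cos (2 * pi * real (Suc j) * t)
       + b j / 4 * cos (2 * pi * real (if j = 0 then 1 else j - 1) * t)))" for t
    unfolding b sum_distrib_left
  proof (rule sum.cong[OF refl])
    fix j
    have 1: "cos (2 * pi * real (Suc j) * t) = cos (2 * pi * real j * t + 2 * pi * t)"
      by (simp add: algebra_simps)
    have 2: "cos (2 * pi * real (if j = 0 then 1 else j - 1) * t) = cos (2 * pi * real j * t - 2 * pi * t)"
    proof (cases j)
      case (Suc i)
      then have "2 * pi * real (if j = 0 then 1 else j - 1) * t = 2 * pi * real j * t - 2 * pi * t"
        by (simp add: algebra_simps)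
      then show ?thesis by (simp only:)
    qed simp
    show "(cos (pi * t))\<^sup>2 * (b j * cos (2 * pi * real j * t)) =
      b j / 2 * cos (2 * pi * real j * t) + (b j / 4 * cos (2 * pi * real (Suc j) * t)
       + b j / 4 * cos (2 * pi * real (if j = 0 then 1 else j - 1) * t))"
      unfolding 1 2 cos_add cos_diff cos_squared_pi by (simp add: field_simps)
  qed
  moreover have "(\<lambda>t. \<Sum>j\<le>m. b j / 2 * cos (2 * pi * real j * t) + (b j / 4 * cos (2 * pi * real (Suc j) * t)
       + b j / 4 * cos (2 * pi * real (if j = 0 then 1 else j - 1) * t))) \<in> cos_sums (Suc m)"
    by (intro cos_sums_sum cos_sums_add cos_sums_cos) auto
  ultimately show ?thesis by simp
qed

lemma cos_sums_mono: "F \<in> cos_sums m \<Longrightarrow> m \<le> k \<Longrightarrow> F \<in> cos_sums k"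
proof -
  assume "F \<in> cos_sums m" "m \<le> k"
  then obtain b where b: "F = (\<lambda>t. \<Sum>j\<le>m. b j * cos (2 * pi * real j * t))"
    by (auto simp: cos_sums_def)
  show "F \<in> cos_sums k"
    unfolding b using \<open>m \<le> k\<close> by (intro cos_sums_sum cos_sums_cos) auto
qed

lemma cos_sums_poly:
  assumes "\<And>k. m < k \<Longrightarrow> coeff p k = 0"
  shows "(\<lambda>t. poly p ((cos (pi * t))\<^sup>2)) \<in> cos_sums m"
proof -
  have pow: "(\<lambda>t. c * ((cos (pi * t))\<^sup>2) ^ i) \<in> cos_sums i" for c i
  proof (induction i)
    case 0
    show ?case using cos_sums_cos[of 0 0 c] by simp
  next
    case (Suc i)
    from cos_sums_mult_x[OF this] show ?case by (simp add: mult_ac)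
  qed
  have "degree p \<le> m" using assms by (intro degree_le) auto
  then show ?thesis unfolding poly_altdef
    by (intro cos_sums_sum cos_sums_mono[OF pow]) auto
qed

text \<open>The division with nonnegative quotient applies to polynomials, so the series is
  truncated. Its nonnegative coefficients make the partial sums lie below the parabola, which then
  serves as the dominating function. Open intervals occur because at \<open>t = 0\<close> and
  \<open>t = 1\<close> the point \<open>x = 1\<close> lies on the boundary of the disc of
  convergence.\<close>

lemma asq_partial_sums_L1:
  assumes "e > 0"
  obtains N where
    "integral {0..1} (\<lambda>t. 4 * pi\<^sup>2 * (t - 1 / 2)\<^sup>2 - (\<Sum>k<N. asq_coeff k * ((cos (pi * t))\<^sup>2) ^ k)) < e"
    "\<And>t. 0 < t \<Longrightarrow> t < 1 \<Longrightarrow> (\<Sum>k<N. asq_coeff k * ((cos (pi * t))\<^sup>2) ^ k) \<le> 4 * pi\<^sup>2 * (t - 1 / 2)\<^sup>2"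
proof -
  let ?A = "\<lambda>t. 4 * pi\<^sup>2 * (t - 1 / 2)\<^sup>2 :: real"
  let ?S = "\<lambda>N t. \<Sum>k<N. asq_coeff k * ((cos (pi * t))\<^sup>2) ^ k"
  have A: "?A integrable_on {0..1}" and S: "?S N integrable_on {0..1}" for N
    by (intro integrable_continuous_interval continuous_intros)+
  have s: "summable (\<lambda>k. asq_coeff k * ((cos (pi * t))\<^sup>2) ^ k)"
    and eq: "(\<Sum>k. asq_coeff k * ((cos (pi * t))\<^sup>2) ^ k) = ?A t"
    if "0 < t" "t < 1" for t
    using summable_asq[of "(cos (pi * t))\<^sup>2"] cos_squared_pi_less_1[OF that] asq_cos_squared[OF that]
    by (simp_all add: asq_def)
  have le: "?S N t \<le> ?A t" if "0 < t" "t < 1" for N t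
    unfolding eq[OF that, symmetric] using asq_coeff_bounds
    by (intro sum_le_suminf s[OF that]) auto
  have "(\<lambda>N. integral {0<..<1} (?S N)) \<longlonglongrightarrow> integral {0<..<1} ?A"
  proof (rule dominated_convergence(2))
    show "?S N integrable_on {0<..<1}" for N
      using S by (simp add: integrable_on_open_interval_real)
    show "?A integrable_on {0<..<1}"
      using A by (simp add: integrable_on_open_interval_real)
    fix t :: real assume t: "t \<in> {0<..<1}"
    have "0 \<le> ?S N t" for N
      using asq_coeff_bounds by (intro sum_nonneg) auto
    then show "norm (?S N t) \<le> ?A t" for N using le[of t N] t by simp
    show "(\<lambda>N. ?S N t) \<longlonglongrightarrow> ?A t"
      using summable_LIMSEQ[OF s[of t]] eq[of t] t by simp
  qed
  then have "(\<lambda>N. integral {0..1} (?S N)) \<longlonglongrightarrow> integral {0..1} ?A"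
    by (simp add: integral_open_interval_real)
  then have "\<forall>\<^sub>F N in sequentially. integral {0..1} ?A - e < integral {0..1} (?S N)"
    using assms by (intro order_tendstoD(1)) auto
  then obtain N where "integral {0..1} ?A - integral {0..1} (?S N) < e"
    by (auto simp: eventually_sequentially algebra_simps)
  then have "integral {0..1} (\<lambda>t. ?A t - ?S N t) < e"
    using A S by (subst Henstock_Kurzweil_Integration.integral_diff) auto
  then show thesis using le by (rule that)
qed

lemma parabola_L1_approx:
  assumes n: "n \<ge> 1" and e: "e > 0"
  obtains F where "F \<in> cos_sums (n - 1)"
    "integral {0..1} (\<lambda>t. \<bar>(t - 1 / 2)\<^sup>2 - F t\<bar>) \<le> 1 / (16 * (real n)\<^sup>2) + e"
proof -
  let ?A = "\<lambda>t. 4 * pi\<^sup>2 * (t - 1 / 2)\<^sup>2 :: real"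
  let ?x = "\<lambda>t. (cos (pi * t))\<^sup>2 :: real"
  \<comment> \<open>The truncation error will enter twice and finally be divided by
    \<open>4 pi^2\<close>, so this tolerance ends up as \<open>e\<close>.\<close>
  obtain N where N: "integral {0..1} (\<lambda>t. ?A t - (\<Sum>k<N. asq_coeff k * (?x t) ^ k)) < 2 * pi\<^sup>2 * e"
    "\<And>t. 0 < t \<Longrightarrow> t < 1 \<Longrightarrow> (\<Sum>k<N. asq_coeff k * (?x t) ^ k) \<le> ?A t"
    using asq_partial_sums_L1[of "2 * pi\<^sup>2 * e"] e by auto
  define p where "p = (\<Sum>k<N. monom (asq_coeff k) k)"
  have p: "poly p x = (\<Sum>k<N. asq_coeff k * x ^ k)" for x
    by (simp add: p_def poly_sum poly_monom)
  have "coeff p k \<ge> 0" for k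
    using asq_coeff_bounds unfolding p_def coeff_sum by (intro sum_nonneg) (simp add: coeff_monom)
  moreover have "finite (cheb_nodes n)" "\<And>a. a \<in> cheb_nodes n \<Longrightarrow> a \<ge> 0"
    by (auto simp: cheb_nodes_def)
  ultimately obtain q r where qr: "p = (\<Prod>a\<in>cheb_nodes n. [:-a, 1:]) * q + r"
    "\<And>k. coeff q k \<ge> 0" "\<And>k. n \<le> k \<Longrightarrow> coeff r k = 0"
    using nonneg_quotient_by_linear_factors[of "cheb_nodes n" p] by (metis card_cheb_nodes)
  define R where "R = (\<lambda>t. poly r (?x t))"
  have R: "R \<in> cos_sums (n - 1)"
    unfolding R_def using qr(3) by (intro cos_sums_poly) auto
  then obtain b where b: "\<And>t. R t = (\<Sum>j\<le>n - 1. b j * cos (2 * pi * real j * t))"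
    by (auto simp: cos_sums_def)
  \<comment> \<open>The interpolation error is the node polynomial times a nonnegative factor, so it
    has the sign of \<open>cos (2 * pi * n * t)\<close>; at the nodes both sides are zero.\<close>
  have sgn: "\<bar>poly p (?x t) - R t\<bar> = sgn_cos n t * (poly p (?x t) - R t)" for t
  proof -
    let ?W = "poly (\<Prod>a\<in>cheb_nodes n. [:-a, 1:]) (?x t)"
    have "cos (2 * pi * n * t) = lead_coeff (cheb n) * ?W"
      by (metis poly_cheb cheb_factor poly_smult)
    then have "sgn_cos n t = sgn ?W"
      using degree_cheb[of n] by (auto simp: sgn_cos_def sgn_mult)
    moreover have "poly p (?x t) - R t = ?W * poly q (?x t)"
      by (simp add: R_def qr(1))
    moreover have "poly q (?x t) \<ge> 0"
      by (rule poly_nonneg_coeffs[OF qr(2)]) simp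
    ultimately show ?thesis by (simp add: abs_mult) (simp add: abs_sgn mult_ac)
  qed
  have contR: "continuous_on S R" for S unfolding R_def by (intro continuous_intros)
  have intR: "integral {0..1} (\<lambda>t. sgn_cos n t * R t) = 0"
  proof -
    have "integral {0..1} (\<lambda>t. sgn_cos n t * R t) =
        integral {0..1} (\<lambda>t. \<Sum>j\<le>n - 1. b j * (sgn_cos n t * cos (2 * pi * real j * t)))"
      by (simp add: b sum_distrib_left mult_ac)
    also have "\<dots> = (\<Sum>j\<le>n - 1. integral {0..1} (\<lambda>t. b j * (sgn_cos n t * cos (2 * pi * real j * t))))"
      by (intro integral_sum integrable_on_mult_right sgn_cos_integrable_on[where K = 1] finite_atMost)
         (auto intro!: continuous_intros)
    also have "\<dots> = 0"
      using n by (intro sum.neutral) (auto simp: integral_sgn_cos_orthogonal)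
    finally show ?thesis .
  qed
  have R1: "(\<lambda>t. sgn_cos n t * R t) integrable_on {0..1}"
    unfolding b sum_distrib_left
    by (intro integrable_sum finite_atMost)
       (simp add: mult.left_commute, intro integrable_on_mult_right sgn_cos_integrable_on[where K = 1],
        auto intro!: continuous_intros)
  have A1: "((\<lambda>t. sgn_cos n t * ?A t) has_integral 4 * pi\<^sup>2 * (1 / (16 * (real n)\<^sup>2))) {0..1}"
    using has_integral_mult_right[OF integral_sgn_cos_parabola[OF n], of "4 * pi\<^sup>2"]
    by (simp add: mult_ac)
  have D1: "(\<lambda>t. ?A t - poly p (?x t)) integrable_on {0..1}"
    by (intro integrable_continuous_interval continuous_intros)
  \<comment> \<open>This majorant of the error arises from
    \<open>\<bar>p - R\<bar> = sgn_cos n * (p - R)\<close> by writing \<open>p\<close> as the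
    parabola minus the truncation error \<open>d\<close> and using
    \<open>- sgn_cos n * d \<le> d\<close>. Orthogonality makes the \<open>R\<close> term
    vanish.\<close>
  have total: "((\<lambda>t. 2 * (?A t - poly p (?x t)) + sgn_cos n t * ?A t - sgn_cos n t * R t) has_integral
      2 * integral {0..1} (\<lambda>t. ?A t - poly p (?x t)) + 4 * pi\<^sup>2 * (1 / (16 * (real n)\<^sup>2)) - 0) {0..1}"
    using integrable_integral[OF R1] unfolding intR
    by (intro has_integral_diff has_integral_add A1 has_integral_mult_right integrable_integral[OF D1])
  have "integral {0<..<1} (\<lambda>t. \<bar>?A t - R t\<bar>) \<le>
     integral {0<..<1} (\<lambda>t. 2 * (?A t - poly p (?x t)) + sgn_cos n t * ?A t - sgn_cos n t * R t)"
  proof (rule integral_le)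
    show "(\<lambda>t. \<bar>?A t - R t\<bar>) integrable_on {0<..<1}"
      unfolding integrable_on_open_interval_real
      by (intro integrable_continuous_interval continuous_intros contR)
    show "(\<lambda>t. 2 * (?A t - poly p (?x t)) + sgn_cos n t * ?A t - sgn_cos n t * R t) integrable_on {0<..<1}"
      unfolding integrable_on_open_interval_real using total by (rule has_integral_integrable)
    fix t :: real assume t: "t \<in> {0<..<1}"
    define d where "d = ?A t - poly p (?x t)"
    have d: "d \<ge> 0" using N(2)[of t] t by (simp add: d_def p)
    have "\<bar>?A t - R t\<bar> \<le> d + \<bar>poly p (?x t) - R t\<bar>"
      using d by (simp add: d_def)
    also have "\<dots> = d - sgn_cos n t * d + sgn_cos n t * ?A t - sgn_cos n t * R t"
      unfolding sgn d_def by (simp add: algebra_simps)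
    also have "- sgn_cos n t * d \<le> 1 * d"
      using abs_sgn_cos_le_1[of n t] d by (intro mult_right_mono) auto
    then have "d - sgn_cos n t * d + sgn_cos n t * ?A t - sgn_cos n t * R t
       \<le> 2 * d + sgn_cos n t * ?A t - sgn_cos n t * R t" by simp
    finally show "\<bar>?A t - R t\<bar> \<le> 2 * (?A t - poly p (?x t)) + sgn_cos n t * ?A t - sgn_cos n t * R t"
      unfolding d_def .
  qed
  then have "integral {0..1} (\<lambda>t. \<bar>?A t - R t\<bar>) \<le>
     integral {0..1} (\<lambda>t. 2 * (?A t - poly p (?x t)) + sgn_cos n t * ?A t - sgn_cos n t * R t)"
    unfolding integral_open_interval_real .
  also have "\<dots> = 2 * integral {0..1} (\<lambda>t. ?A t - poly p (?x t)) + 4 * pi\<^sup>2 * (1 / (16 * (real n)\<^sup>2))"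
    using integral_unique[OF total] by simp
  also have "\<dots> \<le> 2 * (2 * pi\<^sup>2 * e) + 4 * pi\<^sup>2 * (1 / (16 * (real n)\<^sup>2))"
    using N(1) unfolding p by linarith
  also have "\<dots> = 4 * pi\<^sup>2 * (1 / (16 * (real n)\<^sup>2) + e)" by (simp add: algebra_simps)
  also have "(\<lambda>t. \<bar>?A t - R t\<bar>) = (\<lambda>t. 4 * pi\<^sup>2 * \<bar>(t - 1 / 2)\<^sup>2 - R t / (4 * pi\<^sup>2)\<bar>)"
  proof
    fix t
    have "?A t - R t = 4 * pi\<^sup>2 * ((t - 1 / 2)\<^sup>2 - R t / (4 * pi\<^sup>2))"
      by (simp add: right_diff_distrib)
    then show "\<bar>?A t - R t\<bar> = 4 * pi\<^sup>2 * \<bar>(t - 1 / 2)\<^sup>2 - R t / (4 * pi\<^sup>2)\<bar>"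
      by (simp only: abs_mult) simp
  qed
  finally have "4 * pi\<^sup>2 * integral {0..1} (\<lambda>t. \<bar>(t - 1 / 2)\<^sup>2 - R t / (4 * pi\<^sup>2)\<bar>)
       \<le> 4 * pi\<^sup>2 * (1 / (16 * (real n)\<^sup>2) + e)"
    by simp
  then have "integral {0..1} (\<lambda>t. \<bar>(t - 1 / 2)\<^sup>2 - R t / (4 * pi\<^sup>2)\<bar>) \<le> 1 / (16 * (real n)\<^sup>2) + e"
    by (subst (asm) mult_le_cancel_left_pos) auto
  moreover have "(\<lambda>t. R t / (4 * pi\<^sup>2)) = (\<lambda>t. \<Sum>j\<le>n - 1. b j / (4 * pi\<^sup>2) * cos (2 * pi * real j * t))"
    by (simp add: b sum_divide_distrib)
  then have "(\<lambda>t. R t / (4 * pi\<^sup>2)) \<in> cos_sums (n - 1)"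
    by (simp only:) (intro cos_sums_sum cos_sums_cos, simp)
  ultimately show thesis by (rule that[rotated])
qed

section \<open>Favard's inequality for the second derivative\<close>

lemma trig_polys_cos_sin:
  assumes "j \<le> m"
  shows "(\<lambda>t. c * cos (2 * pi * real j * t) + s * sin (2 * pi * real j * t)) \<in> trig_polys m"
proof -
  \<comment> \<open>With this \<open>z\<close>, \<open>c cos \<theta> + s sin \<theta>\<close> is
    \<open>z exp (i \<theta>)\<close> plus its conjugate. Writing the coefficients as a sum of two
    conditionals covers \<open>j = 0\<close>, where both contributions fall on the same index and
    add up to the real number \<open>c\<close>.\<close>
  define z where "z = Complex c (- s) / 2"
  define a where "a = (\<lambda>i. (if i = int j then z else 0) + (if i = - int j then cnj z else 0))"
  have "complex_of_real (c * cos (2 * pi * real j * t) + s * sin (2 * pi * real j * t)) =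
    (\<Sum>i = - int m..int m. a i * exp (2 * of_real pi * \<i> * of_int i * of_real t))" for t
  proof -
    let ?E = "\<lambda>i. exp (2 * of_real pi * \<i> * of_int i * of_real t)"
    have E: "?E (int j) = cis (2 * pi * j * t)" "?E (- int j) = cis (- (2 * pi * j * t))"
      by (simp_all add: cis_conv_exp mult_ac)
    have "(\<Sum>i = - int m..int m. a i * ?E i) =
      (\<Sum>i = - int m..int m. (if i = int j then z * ?E i else 0)) +
      (\<Sum>i = - int m..int m. (if i = - int j then cnj z * ?E i else 0))"
      unfolding sum.distrib[symmetric] by (intro sum.cong) (auto simp: a_def algebra_simps)
    also have "\<dots> = z * ?E (int j) + cnj z * ?E (- int j)"
      using assms by (subst (1 2) sum.delta) auto
    also have "\<dots> = complex_of_real (c * cos (2 * pi * real j * t) + s * sin (2 * pi * real j * t))"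
      unfolding E by (simp add: z_def complex_eq_iff) (simp add: field_simps)
    finally show ?thesis by simp
  qed
  moreover have "a i = cnj (a (- i))" for i
    unfolding a_def by auto
  ultimately show ?thesis unfolding trig_polys_def by blast
qed

lemma trig_polys_add:
  assumes "F \<in> trig_polys m" "G \<in> trig_polys m"
  shows "(\<lambda>t. F t + G t) \<in> trig_polys m"
proof -
  let ?E = "\<lambda>i t. exp (2 * of_real pi * \<i> * of_int i * of_real t) :: complex"
  obtain a b where a: "\<forall>j\<in>{- int m..int m}. a j = cnj (a (- j))"
    "\<forall>t. complex_of_real (F t) = (\<Sum>i = - int m..int m. a i * ?E i t)"
    and b: "\<forall>j\<in>{- int m..int m}. b j = cnj (b (- j))"
    "\<forall>t. complex_of_real (G t) = (\<Sum>i = - int m..int m. b i * ?E i t)"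
    using assms unfolding trig_polys_def by blast
  have 1: "\<forall>j\<in>{- int m..int m}. a j + b j = cnj (a (- j) + b (- j))"
    unfolding complex_cnj_add using a(1) b(1) by metis
  have 2: "\<forall>t. complex_of_real (F t + G t) = (\<Sum>i = - int m..int m. (a i + b i) * ?E i t)"
  proof
    fix t
    have "complex_of_real (F t + G t) =
        (\<Sum>i = - int m..int m. a i * ?E i t) + (\<Sum>i = - int m..int m. b i * ?E i t)"
      unfolding of_real_add using a(2) b(2) by metis
    also have "\<dots> = (\<Sum>i = - int m..int m. (a i + b i) * ?E i t)"
      unfolding sum.distrib[symmetric] by (simp only: distrib_right)
    finally show "complex_of_real (F t + G t) = (\<Sum>i = - int m..int m. (a i + b i) * ?E i t)" .
  qed
  show ?thesis unfolding trig_polys_def mem_Collect_eq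
    by (rule exI[of _ "\<lambda>i. a i + b i"]) (rule conjI[OF 1 2])
qed

lemma trig_polys_sum:
  assumes "\<And>i. i \<in> I \<Longrightarrow> F i \<in> trig_polys m"
  shows "(\<lambda>t. \<Sum>i\<in>I. F i t) \<in> trig_polys m"
  using assms
proof (induction I rule: infinite_finite_induct)
  case (insert i I)
  then show ?case using trig_polys_add[of "F i" m "\<lambda>t. \<Sum>i\<in>I. F i t"] by simp
qed (use trig_polys_cos_sin[of 0 m 0] in simp_all)

lemma trig_polys_bounded:
  assumes "F \<in> trig_polys m"
  obtains K where "\<And>t. \<bar>F t\<bar> \<le> K"
proof -
  obtain a where a: "\<And>t. complex_of_real (F t) =
      (\<Sum>i = - int m..int m. a i * exp (2 * of_real pi * \<i> * of_int i * of_real t))"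
    using assms unfolding trig_polys_def by blast
  have "\<bar>F t\<bar> \<le> (\<Sum>i = - int m..int m. norm (a i))" for t
  proof -
    have "\<bar>F t\<bar> = norm (complex_of_real (F t))" by simp
    also have "\<dots> \<le> (\<Sum>i = - int m..int m. norm (a i))"
      unfolding a by (rule order.trans[OF norm_sum]) (simp add: norm_mult)
    finally show ?thesis .
  qed
  then show thesis by (rule that)
qed

text \<open>Periodicity allows the substitution \<open>u = x + t\<close>; expanding
  \<open>cos (2 pi j (u - x))\<close> then separates \<open>x\<close> from the integration variable,
  leaving the Fourier integrals \<open>C j\<close> and \<open>S j\<close>.\<close>

lemma periodic_convolution_cos_sums:
  fixes p :: "real \<Rightarrow> real"
  assumes p: "continuous_on UNIV p" "\<And>t. p (t + 1) = p t" and F: "F \<in> cos_sums m"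
  shows "(\<lambda>x. integral {0..1} (\<lambda>t. p (x + t) * F t)) \<in> trig_polys m"
proof -
  have cont: "continuous_on S p" for S using p(1) continuous_on_subset by blast
  have cp: "continuous_on S (\<lambda>t. p (x + t))" for x S
    by (intro continuous_on_compose2[OF p(1)] continuous_intros) auto
  obtain b where b: "\<And>t. F t = (\<Sum>j\<le>m. b j * cos (2 * pi * real j * t))"
    using F by (auto simp: cos_sums_def)
  define C where "C = (\<lambda>j. integral {0..1} (\<lambda>u. p u * cos (2 * pi * real j * u)))"
  define S where "S = (\<lambda>j. integral {0..1} (\<lambda>u. p u * sin (2 * pi * real j * u)))"
  have coeffs: "integral {0..1} (\<lambda>t. p (x + t) * cos (2 * pi * real j * t)) =
      C j * cos (2 * pi * real j * x) + S j * sin (2 * pi * real j * x)" for j x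
  proof -
    let ?q = "\<lambda>u. p u * cos (2 * pi * real j * (u - x))"
    have "?q (t + 1) = ?q t" for t
    proof -
      have "2 * pi * real j * (t + 1 - x) = 2 * pi * real j * (t - x) + 2 * of_nat j * pi"
        by (simp add: algebra_simps)
      then show ?thesis using p(2)[of t] by (simp only: cos_add) simp
    qed
    moreover have "?q integrable_on {a..c}" for a c
      by (intro integrable_continuous_interval continuous_intros cont)
    ultimately have "integral {0..1} (\<lambda>t. ?q (x + t)) = integral {0..1} ?q"
      by (intro integral_periodic_shift) auto
    also have "integral {0..1} ?q = integral {0..1} (\<lambda>u. cos (2 * pi * real j * x) * (p u * cos (2 * pi * real j * u))
        + sin (2 * pi * real j * x) * (p u * sin (2 * pi * real j * u)))"
      by (simp add: right_diff_distrib cos_diff algebra_simps fun_eq_iff)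
    also have "\<dots> = cos (2 * pi * real j * x) * C j + sin (2 * pi * real j * x) * S j"
      unfolding C_def S_def integral_mult_right[symmetric]
      by (intro Henstock_Kurzweil_Integration.integral_add integrable_continuous_interval
          continuous_intros cont)
    finally show ?thesis unfolding add_diff_cancel_left' by (simp only: mult.commute)
  qed
  have "integral {0..1} (\<lambda>t. p (x + t) * F t) =
      (\<Sum>j\<le>m. b j * C j * cos (2 * pi * real j * x) + b j * S j * sin (2 * pi * real j * x))" for x
  proof -
    have "integral {0..1} (\<lambda>t. p (x + t) * F t) =
        integral {0..1} (\<lambda>t. \<Sum>j\<le>m. b j * (p (x + t) * cos (2 * pi * real j * t)))"
      unfolding b sum_distrib_left by (simp only: mult.left_commute)
    also have "\<dots> = (\<Sum>j\<le>m. integral {0..1} (\<lambda>t. b j * (p (x + t) * cos (2 * pi * real j * t))))"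
      by (intro integral_sum finite_atMost integrable_continuous_interval continuous_intros cp)
    also have "\<dots> = (\<Sum>j\<le>m. b j * (C j * cos (2 * pi * real j * x) + S j * sin (2 * pi * real j * x)))"
      by (simp only: integral_mult_right coeffs)
    finally show ?thesis by (simp only: distrib_left mult.assoc)
  qed
  then show ?thesis
    by (simp only:) (intro trig_polys_sum trig_polys_cos_sin, simp)
qed

text \<open>Both integrations by parts are packed into the primitive \<open>?H\<close>. The parabola
  has equal values at 0 and 1, so the terms in \<open>g'\<close> cancel by periodicity, whereas its
  slope goes from -1 to 1 and leaves \<open>- 2 * g x\<close>.\<close>

lemma periodic_parabola_representation:
  fixes g g' p :: "real \<Rightarrow> real"
  assumes g: "\<And>x. (g has_real_derivative g' x) (at x)"
    and g': "\<And>x. (g' has_real_derivative p x) (at x)"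
    and p: "continuous_on UNIV p"
    and per: "\<And>x. g (x + 1) = g x" "\<And>x. g' (x + 1) = g' x"
  shows "g x = integral {0..1} g - 1 / 2 * integral {0..1} (\<lambda>t. p (x + t) * (t - 1 / 2)\<^sup>2)"
proof -
  have cg: "continuous_on UNIV g" using g by (rule DERIV_continuous_on)
  have cont: "continuous_on S (\<lambda>t. g (x + t))" "continuous_on S (\<lambda>t. p (x + t))" for S
    by (intro continuous_on_compose2[OF cg] continuous_on_compose2[OF p] continuous_intros; auto)+
  let ?H = "\<lambda>t. g' (x + t) * (t - 1 / 2)\<^sup>2 - 2 * (t - 1 / 2) * g (x + t)"
  have "(?H has_real_derivative p (x + t) * (t - 1 / 2)\<^sup>2 - 2 * g (x + t)) (at t)" for t
  proof -
    have 1: "((\<lambda>t. g (x + t)) has_real_derivative g' (x + t)) (at t)"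
      and 2: "((\<lambda>t. g' (x + t)) has_real_derivative p (x + t)) (at t)"
      using g[of "t + x"] g'[of "t + x"] unfolding DERIV_shift by (simp_all only: add.commute)
    show ?thesis
      by (rule derivative_eq_intros refl 1 2)+ (simp add: algebra_simps)
  qed
  then have "((\<lambda>t. p (x + t) * (t - 1 / 2)\<^sup>2 - 2 * g (x + t)) has_integral ?H 1 - ?H 0) {0..1}"
    by (intro fundamental_theorem_of_calculus)
       (auto simp: has_real_derivative_iff_has_vector_derivative[symmetric]
         intro: has_field_derivative_at_within)
  moreover have "?H 1 - ?H 0 = - 2 * g x"
    using per[of x] by (simp add: power2_eq_square)
  moreover have "integral {0..1} (\<lambda>t. p (x + t) * (t - 1 / 2)\<^sup>2 - 2 * g (x + t))
      = integral {0..1} (\<lambda>t. p (x + t) * (t - 1 / 2)\<^sup>2) - integral {0..1} (\<lambda>t. 2 * g (x + t))"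
    by (intro Henstock_Kurzweil_Integration.integral_diff integrable_continuous_interval
        continuous_intros cont)
  moreover have "integral {0..1} (\<lambda>t. 2 * g (x + t)) = 2 * integral {0..1} (\<lambda>t. g (x + t))"
    by simp
  moreover have "integral {0..1} (\<lambda>t. g (x + t)) = integral {0..1} g"
    using per(1) by (intro integral_periodic_shift integrable_continuous_interval
       continuous_on_subset[OF cg]) auto
  ultimately show ?thesis by (simp add: integral_unique)
qed

text \<open>Replacing the parabola by \<open>F\<close> in the representation of \<open>g\<close>
  gives a trigonometric polynomial. The factor \<open>1/2\<close> there halves the mean error
  \<open>1 / (16 n^2) + 2 e\<close>, and the bound \<open>M\<close> on \<open>p\<close> multiplies
  it.\<close>

lemma favard_second_derivative:
  fixes g g' p :: "real \<Rightarrow> real"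
  assumes g: "\<And>x. (g has_real_derivative g' x) (at x)"
    and g': "\<And>x. (g' has_real_derivative p x) (at x)"
    and p: "continuous_on UNIV p"
    and per: "\<And>x. g (x + 1) = g x" "\<And>x. g' (x + 1) = g' x" "\<And>x. p (x + 1) = p x"
    and M: "\<And>x. \<bar>p x\<bar> \<le> M" and n: "n \<ge> 1" and e: "e > 0"
  obtains \<tau> where "\<tau> \<in> trig_polys (n - 1)" "\<And>x. \<bar>g x - \<tau> x\<bar> \<le> M * (1 / (32 * (real n)\<^sup>2) + e)"
proof -
  obtain F where F: "F \<in> cos_sums (n - 1)"
    "integral {0..1} (\<lambda>t. \<bar>(t - 1 / 2)\<^sup>2 - F t\<bar>) \<le> 1 / (16 * (real n)\<^sup>2) + 2 * e"
    using parabola_L1_approx[OF n, of "2 * e"] e by auto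
  have cF: "continuous_on S F" for S
  proof -
    obtain b where "F = (\<lambda>t. \<Sum>j\<le>n - 1. b j * cos (2 * pi * real j * t))"
      using F(1) by (auto simp: cos_sums_def)
    then show ?thesis by (auto intro!: continuous_intros)
  qed
  have cp: "continuous_on S (\<lambda>t. c * p (x + t))" for c x S
    by (intro continuous_intros continuous_on_compose2[OF p]) auto
  define \<tau> where "\<tau> = (\<lambda>x. integral {0..1} g + integral {0..1} (\<lambda>t. (- 1 / 2) * p (x + t) * F t))"
  have "\<tau> \<in> trig_polys (n - 1)"
    unfolding \<tau>_def
    using trig_polys_cos_sin[of 0 "n - 1" "integral {0..1} g" 0]
      periodic_convolution_cos_sums[OF cp[of UNIV "- 1 / 2" 0, simplified] _ F(1)] per(3)
    by (intro trig_polys_add) auto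
  moreover have "\<bar>g x - \<tau> x\<bar> \<le> M * (1 / (32 * (real n)\<^sup>2) + e)" for x
  proof -
    have "M \<ge> 0" using M[of 0] by linarith
    have "g x - \<tau> x = integral {0..1} (\<lambda>t. (- 1 / 2) * p (x + t) * (t - 1 / 2)\<^sup>2)
       - integral {0..1} (\<lambda>t. (- 1 / 2) * p (x + t) * F t)"
      using periodic_parabola_representation[OF g g' p per(1,2), of x]
      by (simp add: \<tau>_def mult.assoc)
    also have "\<dots> = integral {0..1} (\<lambda>t. (- 1 / 2) * p (x + t) * (t - 1 / 2)\<^sup>2 - (- 1 / 2) * p (x + t) * F t)"
      (is "_ = ?I")
      by (intro Henstock_Kurzweil_Integration.integral_diff[symmetric] integrable_continuous_interval
          continuous_intros cp cF)
    finally have "\<bar>g x - \<tau> x\<bar> = norm ?I" by (simp only: real_norm_def)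
    also have "\<dots> \<le> integral {0..1} (\<lambda>t. M / 2 * \<bar>(t - 1 / 2)\<^sup>2 - F t\<bar>)"
    proof (rule integral_norm_bound_integral)
      show "(\<lambda>t. - 1 / 2 * p (x + t) * (t - 1 / 2)\<^sup>2 - - 1 / 2 * p (x + t) * F t) integrable_on {0..1}"
        by (intro integrable_continuous_interval continuous_intros cp cF)
      show "(\<lambda>t. M / 2 * \<bar>(t - 1 / 2)\<^sup>2 - F t\<bar>) integrable_on {0..1}"
        by (intro integrable_continuous_interval continuous_intros cF)
      fix t
      have "- 1 / 2 * p (x + t) * (t - 1 / 2)\<^sup>2 - - 1 / 2 * p (x + t) * F t
        = - (p (x + t) / 2 * ((t - 1 / 2)\<^sup>2 - F t))" by (simp add: algebra_simps)
      then show "norm (- 1 / 2 * p (x + t) * (t - 1 / 2)\<^sup>2 - - 1 / 2 * p (x + t) * F t)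
          \<le> M / 2 * \<bar>(t - 1 / 2)\<^sup>2 - F t\<bar>"
        using M[of "x + t"] by (simp only: real_norm_def abs_minus_cancel abs_mult) (intro mult_right_mono, auto)
    qed
    also have "\<dots> = M / 2 * integral {0..1} (\<lambda>t. \<bar>(t - 1 / 2)\<^sup>2 - F t\<bar>)" by simp
    also have "\<dots> \<le> M / 2 * (1 / (16 * (real n)\<^sup>2) + 2 * e)"
      using F(2) \<open>M \<ge> 0\<close> by (intro mult_left_mono) auto
    also have "\<dots> = M * (1 / (32 * (real n)\<^sup>2) + e)" by (simp add: distrib_left)
    finally show ?thesis .
  qed
  ultimately show thesis by (rule that)
qed

section \<open>Convolution with box and hat functions\<close>

lemma antiderivative_UNIV:
  fixes f :: "real \<Rightarrow> real"
  assumes "continuous_on UNIV f"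
  obtains F where "\<And>x. (F has_real_derivative f x) (at x)"
proof -
  have "\<exists>F. \<forall>x::real. - \<infinity> < ereal x \<longrightarrow> ereal x < \<infinity> \<longrightarrow> (F has_vector_derivative f x) (at x)"
    using assms by (intro einterval_antiderivative) (auto simp: continuous_on_eq_continuous_at)
  then show thesis
    using that by (auto simp: has_real_derivative_iff_has_vector_derivative)
qed

text \<open>The kernels are given by cases on the whole line. The values of \<open>k\<close> at
  \<open>a\<close> and \<open>b\<close> are left free, since two points form a null set.\<close>

lemma has_bochner_integral_FTC_on_interval:
  fixes k h G :: "real \<Rightarrow> real"
  assumes "a \<le> b" "continuous_on UNIV h" "\<And>x. (G has_real_derivative h x) (at x)"
    and [measurable]: "k \<in> borel_measurable borel"
    and in_ab: "\<And>x. a < x \<Longrightarrow> x < b \<Longrightarrow> k x = h x" and out: "\<And>x. x < a \<or> b < x \<Longrightarrow> k x = 0"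
  shows "has_bochner_integral lborel k (G b - G a)"
proof -
  have [measurable]: "h \<in> borel_measurable borel"
    using assms(2) by (rule borel_measurable_continuous_onI)
  have "has_bochner_integral lborel (\<lambda>x. h x * indicator {a..b} x) (G b - G a)"
    using assms(1-3)
    by (intro has_bochner_integral_FTC_Icc_real) (auto simp: continuous_on_eq_continuous_at)
  moreover have "AE x in lborel. h x * indicator {a..b} x = k x"
    using AE_lborel_singleton[of a] AE_lborel_singleton[of b]
  proof eventually_elim
    case (elim x)
    then show ?case using in_ab[of x] out[of x] by (cases "x < a"; cases "b < x") auto
  qed
  ultimately show ?thesis
    by (subst (asm) has_bochner_integral_cong_AE) auto
qed

lemma chi_borel [measurable]: "chi u \<in> borel_measurable borel"
  unfolding chi_def[abs_def] by measurable

lemma conv_chi: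
  assumes "u > 0" and f: "continuous_on UNIV f" and F: "\<And>x. (F has_real_derivative f x) (at x)"
  shows "conv f (chi u) t = (F (t + u / 2) - F (t - u / 2)) / u"
proof -
  have [measurable]: "f \<in> borel_measurable borel"
    using f by (rule borel_measurable_continuous_onI)
  have "has_bochner_integral lborel (\<lambda>v. f v * chi u (t - v)) (F (t + u / 2) / u - F (t - u / 2) / u)"
  proof (rule has_bochner_integral_FTC_on_interval[where G = "\<lambda>x. F x / u" and h = "\<lambda>x. f x / u"])
    show "continuous_on UNIV (\<lambda>x. f x / u)" using f by (auto intro!: continuous_intros simp: \<open>u > 0\<close>[THEN less_imp_neq, symmetric])
    show "((\<lambda>x. F x / u) has_real_derivative f x / u) (at x)" for x
      by (rule DERIV_cdivide[OF F])
  qed (use \<open>u > 0\<close> in \<open>auto simp: chi_def\<close>)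
  then show ?thesis
    unfolding conv_def by (simp add: has_bochner_integral_integral_eq diff_divide_distrib)
qed

lemma chi_pow_2:
  assumes "u > 0"
  shows "chi_pow 2 u t = (if \<bar>t\<bar> < u then (u - \<bar>t\<bar>) / u\<^sup>2 else 0)"
proof -
  have 2: "chi_pow 2 u t = (\<integral>v. chi u v * chi u (t - v) \<partial>lborel)"
    by (simp add: numeral_2_eq_2 conv_def)
  show ?thesis
  proof (cases "\<bar>t\<bar> < u")
    case True
    \<comment> \<open>\<open>a\<close> and \<open>b\<close> bound the overlap of the supports of the
      two boxes, centred at 0 and \<open>t\<close>; its length is
      \<open>u - \<bar>t\<bar>\<close>.\<close>
    define a where "a = max (- u / 2) (t - u / 2)"
    define b where "b = min (u / 2) (t + u / 2)"
    have "has_bochner_integral lborel (\<lambda>v. chi u v * chi u (t - v)) (b / u\<^sup>2 - a / u\<^sup>2)"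
    proof (rule has_bochner_integral_FTC_on_interval[where G = "\<lambda>x. x / u\<^sup>2" and h = "\<lambda>x. 1 / u\<^sup>2"])
      show "a \<le> b" using True unfolding a_def b_def by (auto simp: min_def max_def)
      show "((\<lambda>x. x / u\<^sup>2) has_real_derivative 1 / u\<^sup>2) (at x)" for x
        by (rule DERIV_cdivide) simp
    qed (auto simp: chi_def a_def b_def power2_eq_square)
    moreover have "b - a = u - \<bar>t\<bar>"
      by (auto simp: a_def b_def min_def max_def)
    ultimately show ?thesis
      using True unfolding 2
      by (simp add: has_bochner_integral_integral_eq diff_divide_distrib[symmetric])
  next
    case False
    then have "(\<lambda>v. chi u v * chi u (t - v)) = (\<lambda>v. 0)" by (auto simp: chi_def fun_eq_iff)
    then show ?thesis using False unfolding 2 by simp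
  qed
qed

text \<open>The hat is split at its kink \<open>v = t\<close>. On either side it is affine, and
  integration by parts supplies the primitive; the two terms with \<open>F t\<close> cancel and a
  second difference of \<open>G\<close> remains.\<close>

lemma conv_chi_pow_2:
  assumes u: "u > 0" and f: "continuous_on UNIV f"
    and F: "\<And>x. (F has_real_derivative f x) (at x)" and G: "\<And>x. (G has_real_derivative F x) (at x)"
  shows "conv f (chi_pow 2 u) t = (G (t + u) + G (t - u) - 2 * G t) / u\<^sup>2"
proof -
  have [measurable]: "f \<in> borel_measurable borel"
    using f by (rule borel_measurable_continuous_onI)
  let ?w = "\<lambda>v. if \<bar>t - v\<bar> < u then (u - \<bar>t - v\<bar>) / u\<^sup>2 else 0"
  have l: "has_bochner_integral lborel (\<lambda>v. if v \<le> t then f v * ?w v else 0)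
      (((u - t + t) * F t - G t) / u\<^sup>2 - ((u - t + (t - u)) * F (t - u) - G (t - u)) / u\<^sup>2)"
  proof (rule has_bochner_integral_FTC_on_interval[where G = "\<lambda>v. ((u - t + v) * F v - G v) / u\<^sup>2"
        and h = "\<lambda>v. f v * (u - t + v) / u\<^sup>2"])
    show "continuous_on UNIV (\<lambda>v. f v * (u - t + v) / u\<^sup>2)"
      using f u by (auto intro!: continuous_intros)
    show "((\<lambda>v. ((u - t + v) * F v - G v) / u\<^sup>2) has_real_derivative f v * (u - t + v) / u\<^sup>2) (at v)" for v
      by (rule DERIV_cdivide) ((rule derivative_eq_intros refl F G)+, simp add: algebra_simps)
  qed (use u in \<open>auto simp: abs_if\<close>)
  have r: "has_bochner_integral lborel (\<lambda>v. if v \<le> t then 0 else f v * ?w v)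
      (((u + t - (t + u)) * F (t + u) + G (t + u)) / u\<^sup>2 - ((u + t - t) * F t + G t) / u\<^sup>2)"
  proof (rule has_bochner_integral_FTC_on_interval[where G = "\<lambda>v. ((u + t - v) * F v + G v) / u\<^sup>2"
        and h = "\<lambda>v. f v * (u + t - v) / u\<^sup>2"])
    show "continuous_on UNIV (\<lambda>v. f v * (u + t - v) / u\<^sup>2)"
      using f u by (auto intro!: continuous_intros)
    show "((\<lambda>v. ((u + t - v) * F v + G v) / u\<^sup>2) has_real_derivative f v * (u + t - v) / u\<^sup>2) (at v)" for v
      by (rule DERIV_cdivide) ((rule derivative_eq_intros refl F G)+, simp add: algebra_simps)
  qed (use u in \<open>auto simp: abs_if\<close>)
  have "(\<lambda>v. f v * chi_pow 2 u (t - v)) =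
      (\<lambda>v. (if v \<le> t then f v * ?w v else 0) + (if v \<le> t then 0 else f v * ?w v))"
    unfolding chi_pow_2[OF u] by auto
  then have "conv f (chi_pow 2 u) t = ((u - t + t) * F t - G t) / u\<^sup>2 - ((u - t + (t - u)) * F (t - u) - G (t - u)) / u\<^sup>2
     + (((u + t - (t + u)) * F (t + u) + G (t + u)) / u\<^sup>2 - ((u + t - t) * F t + G t) / u\<^sup>2)"
    unfolding conv_def using has_bochner_integral_add[OF l r]
    by (simp only: has_bochner_integral_integral_eq)
  also have "\<dots> = (G (t + u) + G (t - u) - 2 * G t) / u\<^sup>2"
    by (simp add: diff_divide_distrib add_divide_distrib)
  finally show ?thesis .
qed

section \<open>Bounds and periodicity of the convolutions\<close>

lemma mean_value_bound:
  fixes G g :: "real \<Rightarrow> real"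
  assumes "u > 0" "\<And>x. (G has_real_derivative g x) (at x)" "\<And>x. \<bar>g x\<bar> \<le> K"
  shows "\<bar>(G (t + u / 2) - G (t - u / 2)) / u\<bar> \<le> K"
proof -
  obtain z where "G (t + u / 2) - G (t - u / 2) = (t + u / 2 - (t - u / 2)) * g z"
    using MVT2[of "t - u / 2" "t + u / 2" G g] assms by auto
  then show ?thesis using assms by simp
qed

text \<open>Convolving with the hat means averaging over a box twice. This associativity follows
  from the formulas with primitives, a second difference being a difference of differences, so no
  interchange of integrals is involved.\<close>

lemma conv_chi_pow_2_mean:
  assumes u: "u > 0" and f: "continuous_on UNIV f"
    and F: "\<And>x. (F has_real_derivative f x) (at x)"
  obtains H where "\<And>x. (H has_real_derivative conv f (chi u) x) (at x)"
    "\<And>t. conv f (chi_pow 2 u) t = (H (t + u / 2) - H (t - u / 2)) / u"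
proof -
  have "continuous_on UNIV F" using F by (rule DERIV_continuous_on)
  then obtain G where G: "\<And>x. (G has_real_derivative F x) (at x)"
    using antiderivative_UNIV by blast
  show thesis
  proof (rule that)
    have s: "((\<lambda>v. G (v + c)) has_real_derivative F (x + c)) (at x)" for x c
      using G[of "x + c"] unfolding DERIV_shift .
    show "((\<lambda>v. (G (v + u / 2) - G (v - u / 2)) / u) has_real_derivative conv f (chi u) x) (at x)" for x
      unfolding conv_chi[OF u f F]
      using s[of "u / 2" x] s[of "- (u / 2)" x] by (intro DERIV_cdivide DERIV_diff) auto
    show "conv f (chi_pow 2 u) t = ((G (t + u / 2 + u / 2) - G (t + u / 2 - u / 2)) / u
        - (G (t - u / 2 + u / 2) - G (t - u / 2 - u / 2)) / u) / u" for t
      unfolding conv_chi_pow_2[OF u f F G]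
      by (simp add: power2_eq_square diff_divide_distrib[symmetric] algebra_simps)
  qed
qed

lemma conv_chi_bounded:
  assumes u: "u > 0" and f: "continuous_on UNIV f" and K: "\<And>x. \<bar>f x\<bar> \<le> K"
  shows "\<bar>conv f (chi u) t\<bar> \<le> K" "\<bar>conv f (chi_pow 2 u) t\<bar> \<le> K"
proof -
  obtain F where F: "\<And>x. (F has_real_derivative f x) (at x)"
    by (rule antiderivative_UNIV[OF f]) blast
  show 1: "\<bar>conv f (chi u) t\<bar> \<le> K" for t
    unfolding conv_chi[OF u f F] by (rule mean_value_bound[OF u F K])
  obtain H where H: "\<And>x. (H has_real_derivative conv f (chi u) x) (at x)"
    "\<And>t. conv f (chi_pow 2 u) t = (H (t + u / 2) - H (t - u / 2)) / u"
    by (rule conv_chi_pow_2_mean[OF u f F]) blast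
  show "\<bar>conv f (chi_pow 2 u) t\<bar> \<le> K"
    unfolding H(2) by (rule mean_value_bound[OF u H(1) 1])
qed

text \<open>With \<open>r = f - f * \<chi>\<close> for the box \<open>\<chi>\<close> of width
  \<open>u\<close>, the deviation from the twofold average is \<open>r + r * \<chi>\<close>. The
  second term is the mean of a function bounded by \<open>K\<close>, namely a difference quotient of
  \<open>F - H\<close>.\<close>

lemma conv_chi_pow_2_deviation:
  assumes u: "u > 0" and f: "continuous_on UNIV f"
    and K: "\<And>x. \<bar>f x - conv f (chi u) x\<bar> \<le> K"
  shows "\<bar>f t - conv f (chi_pow 2 u) t\<bar> \<le> 2 * K"
proof -
  obtain F where F: "\<And>x. (F has_real_derivative f x) (at x)"
    by (rule antiderivative_UNIV[OF f]) blast
  obtain H where H: "\<And>x. (H has_real_derivative conv f (chi u) x) (at x)"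
    "\<And>t. conv f (chi_pow 2 u) t = (H (t + u / 2) - H (t - u / 2)) / u"
    by (rule conv_chi_pow_2_mean[OF u f F]) blast
  have "\<bar>((F (t + u / 2) - H (t + u / 2)) - (F (t - u / 2) - H (t - u / 2))) / u\<bar> \<le> K"
    by (rule mean_value_bound[OF u DERIV_diff[OF F H(1)] K])
  moreover have "((F (t + u / 2) - H (t + u / 2)) - (F (t - u / 2) - H (t - u / 2))) / u =
      conv f (chi u) t - conv f (chi_pow 2 u) t"
    unfolding conv_chi[OF u f F] H(2) by (simp add: diff_divide_distrib)
  ultimately have "\<bar>conv f (chi u) t - conv f (chi_pow 2 u) t\<bar> \<le> K" by simp
  then show ?thesis using K[of t] by linarith
qed

text \<open>A primitive of a periodic function need not be periodic, but its increment over one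
  period is constant.\<close>

lemma periodic_primitive_difference:
  fixes G g :: "real \<Rightarrow> real"
  assumes G: "\<And>x. (G has_real_derivative g x) (at x)" and per: "\<And>x. g (x + 1) = g x"
  shows "G (x + 1) - G (y + 1) = G x - G y"
proof -
  have "((\<lambda>x. G (x + 1) - G x) has_real_derivative 0) (at x)" for x
  proof -
    have "((\<lambda>x. G (x + 1)) has_real_derivative g x) (at x)"
      using G[of "x + 1"] unfolding DERIV_shift per .
    from DERIV_diff[OF this G] show ?thesis by simp
  qed
  then have "G (x + 1) - G x = G (y + 1) - G y"
    by (intro DERIV_isconst_all) auto
  then show ?thesis by simp
qed

lemma conv_chi_pow_2_periodic:
  assumes u: "u > 0" and f: "continuous_on UNIV f" and per: "\<And>t. f (t + 1) = f t"
  shows "conv f (chi_pow 2 u) (t + 1) = conv f (chi_pow 2 u) t"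
proof -
  obtain F where F: "\<And>x. (F has_real_derivative f x) (at x)"
    by (rule antiderivative_UNIV[OF f]) blast
  have c: "conv f (chi u) (t + 1) = conv f (chi u) t" for t
    using periodic_primitive_difference[OF F per, of "t + u / 2" "t - u / 2"]
    unfolding conv_chi[OF u f F] by (simp add: algebra_simps)
  obtain H where H: "\<And>x. (H has_real_derivative conv f (chi u) x) (at x)"
    "\<And>t. conv f (chi_pow 2 u) t = (H (t + u / 2) - H (t - u / 2)) / u"
    by (rule conv_chi_pow_2_mean[OF u f F]) blast
  show ?thesis
    using periodic_primitive_difference[OF H(1) c, of "t + u / 2" "t - u / 2"]
    unfolding H(2) by (simp add: algebra_simps)
qed

section \<open>The smooth approximant\<close>

lemma abs_le_unorm: "\<bar>f x\<bar> \<le> unorm f" if "\<And>x. \<bar>f x\<bar> \<le> K"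
  unfolding unorm_def using that by (intro cSUP_upper) (auto intro!: bdd_aboveI[of _ K])

lemma unorm_le: "unorm f \<le> K" if "\<And>x. \<bar>f x\<bar> \<le> K"
  unfolding unorm_def using that by (intro cSUP_least) auto

lemma C_T_bounded:
  assumes "f \<in> C_T"
  obtains K where "\<And>x. \<bar>f x\<bar> \<le> K"
proof -
  have f: "continuous_on UNIV f" "\<And>t. f (t + 1) = f t" using assms by (auto simp: C_T_def)
  have "compact (f ` {0..1})"
    using f(1) by (intro compact_continuous_image continuous_on_subset[OF f(1)]) auto
  then have "bounded (f ` {0..1})" by (rule compact_imp_bounded)
  then obtain K where K: "\<And>y. y \<in> {0..1} \<Longrightarrow> \<bar>f y\<bar> \<le> K"
    unfolding bounded_iff real_norm_def by blast
  have "\<bar>f x\<bar> \<le> K" for x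
    using K[of "frac x"] periodic_of_int[of f "frac x" "\<lfloor>x\<rfloor>"] f(2) frac_lt_1[of x]
    by (simp add: frac_def)
  then show thesis by (rule that)
qed

lemma abs_deviation_le_W2_star:
  assumes "f \<in> C_T" "0 < u" "u \<le> h" "k = 1 \<or> k = 2"
  shows "\<bar>f t - conv f (chi_pow k u) t\<bar> \<le> W2_star f k h"
proof -
  obtain K where K: "\<And>x. \<bar>f x\<bar> \<le> K" using C_T_bounded[OF assms(1)] by blast
  have f: "continuous_on UNIV f" using assms(1) by (simp add: C_T_def)
  \<comment> \<open>A bound uniform in both \<open>t\<close> and \<open>u\<close>: it makes the norm
    for each \<open>u\<close> and the supremum over \<open>u\<close> genuine suprema of bounded
    sets.\<close>
  have bd: "\<bar>f t - conv f (chi_pow k u) t\<bar> \<le> 2 * K" if "u > 0" for u t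
    using conv_chi_bounded[OF that f K, of t] K[of t] assms(4) by auto
  have "\<bar>f t - conv f (chi_pow k u) t\<bar> \<le> W2 f (chi_pow k u)"
    unfolding W2_def by (rule abs_le_unorm[OF bd[OF \<open>0 < u\<close>]])
  also have "\<dots> \<le> W2_star f k h"
    unfolding W2_star_def
  proof (rule cSUP_upper)
    show "bdd_above ((\<lambda>u. W2 f (chi_pow k u)) ` {0<..h})"
      by (rule bdd_aboveI[of _ "2 * K"]) (auto simp: W2_def intro!: unorm_le bd)
  qed (use assms in auto)
  finally show ?thesis .
qed

text \<open>The weight \<open>(12 / h\<^sup>4) (h - u) u\<^sup>2\<close> on \<open>[0, h]\<close> has mass 1, so averaging the convolutions
  \<open>f * \<chi>\<^sub>u\<^sup>2\<close> with it stays within \<open>W\<close> of \<open>f\<close>. It is chosen so that the factor \<open>u\<^sup>2\<close> cancels the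
  denominator in \<open>(f * \<chi>\<^sub>u\<^sup>2)'' = \<Delta>\<^sub>u\<^sup>2 f / u\<^sup>2\<close>: the second derivative of the average is then
  exactly \<open>(12 / h\<^sup>2) (f * \<chi>\<^sub>h\<^sup>2 - f)\<close>.\<close>

lemma smooth_approximation:
  assumes f: "f \<in> C_T" and h: "h > 0"
    and W: "\<And>u t. 0 < u \<Longrightarrow> u \<le> h \<Longrightarrow> \<bar>f t - conv f (chi_pow 2 u) t\<bar> \<le> W"
  obtains g g' p where "\<And>x. (g has_real_derivative g' x) (at x)"
    "\<And>x. (g' has_real_derivative p x) (at x)" "continuous_on UNIV p"
    "\<And>x. g (x + 1) = g x" "\<And>x. g' (x + 1) = g' x" "\<And>x. p (x + 1) = p x"
    "\<And>x. \<bar>p x\<bar> \<le> 12 * W / h\<^sup>2" "\<And>x. \<bar>f x - g x\<bar> \<le> W"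
proof -
  have cf: "continuous_on UNIV f" and per: "\<And>t. f (t + 1) = f t" using f by (auto simp: C_T_def)
  obtain F1 where F1: "\<And>x. (F1 has_real_derivative f x) (at x)"
    by (rule antiderivative_UNIV[OF cf]) blast
  obtain F2 where F2: "\<And>x. (F2 has_real_derivative F1 x) (at x)"
    by (rule antiderivative_UNIV[OF DERIV_continuous_on[OF F1]]) blast
  obtain F3 where F3: "\<And>x. (F3 has_real_derivative F2 x) (at x)"
    by (rule antiderivative_UNIV[OF DERIV_continuous_on[OF F2]]) blast
  obtain F4 where F4: "\<And>x. (F4 has_real_derivative F3 x) (at x)"
    by (rule antiderivative_UNIV[OF DERIV_continuous_on[OF F3]]) blast
  \<comment> \<open>Defined through primitives, \<open>g\<close> visibly has \<open>p\<close> as its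
    second derivative. That it is the weighted average of the convolutions is established
    afterwards, in \<open>int'\<close> and \<open>int\<close>.\<close>
  define g where "g = (\<lambda>x. 12 / h\<^sup>2 * ((F4 (x + h) + F4 (x - h) - 2 * F4 x) / h\<^sup>2 - F2 x))"
  define g' where "g' = (\<lambda>x. 12 / h\<^sup>2 * ((F3 (x + h) + F3 (x - h) - 2 * F3 x) / h\<^sup>2 - F1 x))"
  define p where "p = (\<lambda>x. 12 / h\<^sup>2 * ((F2 (x + h) + F2 (x - h) - 2 * F2 x) / h\<^sup>2 - f x))"
  have shift: "((\<lambda>x. G (x + c)) has_real_derivative G' (x + c)) (at x)"
    "((\<lambda>x. G (x - c)) has_real_derivative G' (x - c)) (at x)"
    if "\<And>x. (G has_real_derivative G' x) (at x)" for G G' :: "real \<Rightarrow> real" and c x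
    using that[of "x + c"] that[of "x + - c"] unfolding DERIV_shift by simp_all
  have g: "(g has_real_derivative g' x) (at x)" for x
    unfolding g_def g'_def
    by (intro DERIV_cmult DERIV_diff DERIV_cdivide DERIV_add shift F4 F2)
  have g': "(g' has_real_derivative p x) (at x)" for x
    unfolding g'_def p_def
    by (intro DERIV_cmult DERIV_diff DERIV_cdivide DERIV_add shift F3 F1)
  have D: "F2 (t + u) + F2 (t - u) - 2 * F2 t = u\<^sup>2 * conv f (chi_pow 2 u) t" if "u > 0" for t u
    using that unfolding conv_chi_pow_2[OF that cf F1 F2] by simp
  have p: "p x = 12 / h\<^sup>2 * (conv f (chi_pow 2 h) x - f x)" for x
    unfolding p_def D[OF h] using h by simp
  have cF2: "continuous_on S (\<lambda>x. F2 (x + c))" for S c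
    by (rule continuous_on_compose2[OF DERIV_continuous_on[OF F2]]) (auto intro!: continuous_intros)
  have "continuous_on UNIV p"
    unfolding p_def using h cf cF2[of UNIV h] cF2[of UNIV "- h"] cF2[of UNIV 0]
    by (intro continuous_intros) auto
  \<comment> \<open>By \<open>D\<close> the factor \<open>u^2\<close> turns the convolution into a
    second difference of \<open>F2\<close>, so the weighted integral has the explicit primitive
    \<open>?P\<close>; \<open>h^4 / 12\<close> is the mass of the unnormalized weight
    \<open>(h - u) u^2\<close>.\<close>
  have int': "((\<lambda>u. (h - u) * (F2 (x + u) + F2 (x - u) - 2 * F2 x - u\<^sup>2 * f x)) has_integral
      h ^ 4 / 12 * (g x - f x)) {0..h}" for x
  proof -
    let ?P = "\<lambda>u. (h - u) * (F3 (x + u) - F3 (x - u)) + (F4 (x + u) + F4 (x - u))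
      - 2 * F2 x * (h * u - u\<^sup>2 / 2) - f x * (h * u ^ 3 / 3 - u ^ 4 / 4)"
    have d: "((\<lambda>u. x + u) has_real_derivative 1) (at u)"
      "((\<lambda>u. x - u) has_real_derivative - 1) (at u)" for u
      by (auto intro!: derivative_eq_intros)
    have s: "((\<lambda>u. G (x + u)) has_real_derivative G' (x + u)) (at u)"
      "((\<lambda>u. G (x - u)) has_real_derivative - G' (x - u)) (at u)"
      if "\<And>x. (G has_real_derivative G' x) (at x)" for G G' :: "real \<Rightarrow> real" and u
      using DERIV_chain2[OF that[of "x + u"] d(1)] DERIV_chain2[OF that[of "x - u"] d(2)]
      by simp_all
    have q: "((\<lambda>u. h - u) has_real_derivative - 1) (at u)"
      "((\<lambda>u. h * u - u\<^sup>2 / 2) has_real_derivative h - u) (at u)"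
      "((\<lambda>u. h * u ^ 3 / 3 - u ^ 4 / 4) has_real_derivative h * u\<^sup>2 - u ^ 3) (at u)" for u
      by (auto intro!: derivative_eq_intros)
    have "(?P has_real_derivative (- 1 * (F3 (x + u) - F3 (x - u)) + (F2 (x + u) - - F2 (x - u)) * (h - u))
        + (F3 (x + u) + - F3 (x - u)) - 2 * F2 x * (h - u) - f x * (h * u\<^sup>2 - u ^ 3)) (at u)" for u
      by (intro DERIV_add DERIV_diff DERIV_mult DERIV_cmult q s F3 F4)
    moreover have "(- 1 * (F3 (x + u) - F3 (x - u)) + (F2 (x + u) - - F2 (x - u)) * (h - u))
        + (F3 (x + u) + - F3 (x - u)) - 2 * F2 x * (h - u) - f x * (h * u\<^sup>2 - u ^ 3)
      = (h - u) * (F2 (x + u) + F2 (x - u) - 2 * F2 x - u\<^sup>2 * f x)" for u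
      by (simp add: algebra_simps power2_eq_square power3_eq_cube)
    ultimately have "(?P has_real_derivative (h - u) * (F2 (x + u) + F2 (x - u) - 2 * F2 x - u\<^sup>2 * f x)) (at u)" for u
      by (simp only:)
    then have "((\<lambda>u. (h - u) * (F2 (x + u) + F2 (x - u) - 2 * F2 x - u\<^sup>2 * f x)) has_integral
        ?P h - ?P 0) {0..h}"
      using h by (intro fundamental_theorem_of_calculus)
        (auto simp: has_real_derivative_iff_has_vector_derivative[symmetric]
           intro: has_field_derivative_at_within)
    moreover have "?P h - ?P 0 = h ^ 4 / 12 * (g x - f x)"
      using h by (simp add: g_def field_simps power2_eq_square power3_eq_cube power4_eq_xxxx)
    ultimately show ?thesis by (simp only:)
  qed
  have integrand: "(h - u) * (F2 (x + u) + F2 (x - u) - 2 * F2 x - u\<^sup>2 * f x) =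
      (h - u) * u\<^sup>2 * (conv f (chi_pow 2 u) x - f x)" if "u \<in> {0..h}" for u x
  proof (cases "u = 0")
    case False
    then show ?thesis using that D[of u x] by (simp add: algebra_simps)
  qed simp
  have int: "((\<lambda>u. (h - u) * u\<^sup>2 * (conv f (chi_pow 2 u) x - f x)) has_integral
      h ^ 4 / 12 * (g x - f x)) {0..h}" for x
    by (rule has_integral_eq[OF integrand int'])
  \<comment> \<open>The primitives in the definition of \<open>g\<close> need not be periodic;
    periodicity is read off the integral representation, whose integrand is periodic in
    \<open>x\<close>.\<close>
  have gper: "g (x + 1) = g x" for x
  proof -
    have "((\<lambda>u. (h - u) * u\<^sup>2 * (conv f (chi_pow 2 u) (x + 1) - f (x + 1))) has_integral
        h ^ 4 / 12 * (g x - f x)) {0..h}"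
    proof (rule has_integral_eq[OF _ int])
      fix u assume "u \<in> {0..h}"
      then show "(h - u) * u\<^sup>2 * (conv f (chi_pow 2 u) x - f x) =
          (h - u) * u\<^sup>2 * (conv f (chi_pow 2 u) (x + 1) - f (x + 1))"
        using conv_chi_pow_2_periodic[OF _ cf per, of u x] per by (cases "u = 0") auto
    qed
    then have "h ^ 4 / 12 * (g (x + 1) - f (x + 1)) = h ^ 4 / 12 * (g x - f x)"
      by (rule has_integral_unique[OF int])
    then show ?thesis using h per by simp
  qed
  have g'per: "g' (x + 1) = g' x" for x
    using shift(1)[OF g, of 1 x] g[of x] unfolding gper by (rule DERIV_unique)
  have "\<bar>f x - g x\<bar> \<le> W" for x
  proof -
    have w: "((\<lambda>u. (h - u) * u\<^sup>2 * W) has_integral h ^ 4 / 12 * W) {0..h}"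
    proof -
      have "((\<lambda>u. (h - u) * u\<^sup>2 * W) has_integral
          (h * h ^ 3 / 3 - h ^ 4 / 4) * W - (h * 0 ^ 3 / 3 - 0 ^ 4 / 4) * W) {0..h}"
        using h by (intro fundamental_theorem_of_calculus)
          (auto simp: has_real_derivative_iff_has_vector_derivative[symmetric] algebra_simps
             power2_eq_square power3_eq_cube intro!: derivative_eq_intros)
      moreover have "(h * h ^ 3 / 3 - h ^ 4 / 4) * W - (h * 0 ^ 3 / 3 - 0 ^ 4 / 4) * W = h ^ 4 / 12 * W"
        by (simp add: power3_eq_cube power4_eq_xxxx algebra_simps)
      ultimately show ?thesis by (simp only:)
    qed
    have "norm (integral {0..h} (\<lambda>u. (h - u) * u\<^sup>2 * (conv f (chi_pow 2 u) x - f x)))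
        \<le> integral {0..h} (\<lambda>u. (h - u) * u\<^sup>2 * W)"
    proof (rule integral_norm_bound_integral)
      fix u assume u: "u \<in> {0..h}"
      show "norm ((h - u) * u\<^sup>2 * (conv f (chi_pow 2 u) x - f x)) \<le> (h - u) * u\<^sup>2 * W"
      proof (cases "u = 0")
        case False
        then have "\<bar>conv f (chi_pow 2 u) x - f x\<bar> \<le> W" using W[of u x] u by auto
        then have "\<bar>(h - u) * u\<^sup>2\<bar> * \<bar>conv f (chi_pow 2 u) x - f x\<bar> \<le> \<bar>(h - u) * u\<^sup>2\<bar> * W"
          by (intro mult_left_mono) auto
        then show ?thesis using u by (simp add: abs_mult)
      qed simp
    qed (use int w in blast)+
    then have "\<bar>h ^ 4 / 12 * (g x - f x)\<bar> \<le> h ^ 4 / 12 * W"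
      unfolding integral_unique[OF int] integral_unique[OF w] real_norm_def .
    then have "h ^ 4 / 12 * \<bar>g x - f x\<bar> \<le> h ^ 4 / 12 * W"
      using h by (simp add: abs_mult)
    then have "\<bar>g x - f x\<bar> \<le> W" using h by (subst (asm) mult_le_cancel_left_pos) auto
    then show ?thesis by linarith
  qed
  moreover have "p (x + 1) = p x" for x
    unfolding p using conv_chi_pow_2_periodic[OF h cf per] per by simp
  moreover have "\<bar>p x\<bar> \<le> 12 * W / h\<^sup>2" for x
  proof -
    have "\<bar>p x\<bar> = 12 / h\<^sup>2 * \<bar>f x - conv f (chi_pow 2 h) x\<bar>"
      unfolding p abs_mult by (simp add: abs_minus_commute)
    also have "\<dots> \<le> 12 / h\<^sup>2 * W" by (intro mult_left_mono W h) auto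
    finally show ?thesis by simp
  qed
  ultimately show thesis
    using that[of g g' p] g g' \<open>continuous_on UNIV p\<close> gper g'per by blast
qed

section \<open>From the smooth approximant to the two estimates\<close>

lemma best_approx_le:
  assumes f: "f \<in> C_T" and "\<tau> \<in> trig_polys m" "\<And>x. \<bar>f x - \<tau> x\<bar> \<le> K"
  shows "best_approx m f \<le> K"
proof -
  obtain Kf where Kf: "\<And>x. \<bar>f x\<bar> \<le> Kf" using C_T_bounded[OF f] by blast
  \<comment> \<open>The infimum needs a lower bound for its set. Each norm is nonnegative because
    \<open>f - \<sigma>\<close> is bounded, so that the supremum dominates an actual absolute
    value.\<close>
  have "0 \<le> unorm (\<lambda>t. f t - \<sigma> t)" if s: "\<sigma> \<in> trig_polys m" for \<sigma>
  proof -
    obtain Ks where Ks: "\<And>x. \<bar>\<sigma> x\<bar> \<le> Ks" using trig_polys_bounded[OF s] by blast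
    have b: "\<bar>f t - \<sigma> t\<bar> \<le> Kf + Ks" for t using Kf[of t] Ks[of t] by linarith
    have "\<bar>f 0 - \<sigma> 0\<bar> \<le> unorm (\<lambda>t. f t - \<sigma> t)" by (rule abs_le_unorm[OF b])
    then show ?thesis by linarith
  qed
  then have "bdd_below ((\<lambda>\<tau>. unorm (\<lambda>t. f t - \<tau> t)) ` trig_polys m)"
    by (intro bdd_belowI[of _ 0]) auto
  then have "best_approx m f \<le> unorm (\<lambda>t. f t - \<tau> t)"
    unfolding best_approx_def using assms(2) by (intro cINF_lower) auto
  also have "\<dots> \<le> K" by (rule unorm_le[OF assms(3)])
  finally show ?thesis .
qed

text \<open>The step from \<open>f\<close> to \<open>g\<close> costs \<open>W\<close>. Favard's
  inequality with \<open>M = 12 W / h^2\<close> adds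
  \<open>M / (32 n^2) = 3 W / (8 n^2 h^2)\<close>, up to an arbitrarily small
  \<open>d\<close>.\<close>

lemma best_approx_le_deviation:
  assumes f: "f \<in> C_T" and h: "h > 0" and n: "n \<ge> 1"
    and W: "\<And>u t. 0 < u \<Longrightarrow> u \<le> h \<Longrightarrow> \<bar>f t - conv f (chi_pow 2 u) t\<bar> \<le> W"
  shows "best_approx (n - 1) f \<le> (1 + 3 / (8 * (real n)\<^sup>2 * h\<^sup>2)) * W"
proof (rule field_le_epsilon)
  fix d :: real assume d: "d > 0"
  obtain g g' p where G: "\<And>x. (g has_real_derivative g' x) (at x)"
    "\<And>x. (g' has_real_derivative p x) (at x)" "continuous_on UNIV p"
    "\<And>x. g (x + 1) = g x" "\<And>x. g' (x + 1) = g' x" "\<And>x. p (x + 1) = p x"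
    "\<And>x. \<bar>p x\<bar> \<le> 12 * W / h\<^sup>2" "\<And>x. \<bar>f x - g x\<bar> \<le> W"
    by (rule smooth_approximation[OF f h W]) blast+
  define M where "M = 12 * W / h\<^sup>2"
  have M: "M \<ge> 0" using G(7)[of 0] unfolding M_def by linarith
  \<comment> \<open>Dividing by \<open>M + 1\<close> keeps \<open>e\<close> well defined when
    \<open>M = 0\<close> and still gives \<open>M * e \<le> d\<close>.\<close>
  define e where "e = d / (M + 1)"
  have e: "e > 0" using d M by (simp add: e_def)
  have "M * e \<le> (M + 1) * e" using e by simp
  also have "\<dots> = d" using M by (simp add: e_def)
  finally have Me: "M * e \<le> d" .
  obtain \<tau> where \<tau>: "\<tau> \<in> trig_polys (n - 1)"
    "\<And>x. \<bar>g x - \<tau> x\<bar> \<le> M * (1 / (32 * (real n)\<^sup>2) + e)"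
    by (rule favard_second_derivative[OF G(1-6) G(7)[folded M_def] n e]) blast
  have "\<bar>f x - \<tau> x\<bar> \<le> W + M * (1 / (32 * (real n)\<^sup>2) + e)" for x
    using G(8)[of x] \<tau>(2)[of x] by linarith
  from best_approx_le[OF f \<tau>(1) this]
  have "best_approx (n - 1) f \<le> W + M * (1 / (32 * (real n)\<^sup>2)) + d"
    using Me unfolding distrib_left by linarith
  also have "M * (1 / (32 * (real n)\<^sup>2)) = 3 / (8 * (real n)\<^sup>2 * h\<^sup>2) * W"
    by (simp add: M_def)
  finally show "best_approx (n - 1) f \<le> (1 + 3 / (8 * (real n)\<^sup>2 * h\<^sup>2)) * W + d"
    by (simp add: distrib_right)
qed

theorem theorem3:
  fixes f :: "real \<Rightarrow> real" and \<alpha> :: real and n :: nat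
  defines "c \<equiv> 1 + 3 / (2 * \<alpha>\<^sup>2)"
  assumes "f \<in> C_T" and "\<alpha> > 0" and "n \<ge> 1"
  shows "best_approx (n - 1) f \<le> c * W2_star f 2 (\<alpha> / (2 * real n)) \<and>
         best_approx (n - 1) f \<le> 2 * c * W2_star f 1 (\<alpha> / (2 * real n))"
proof -
  define h where "h = \<alpha> / (2 * real n)"
  have h: "h > 0" using assms(3,4) by (simp add: h_def)
  \<comment> \<open>For \<open>h = \<alpha> / (2 n)\<close> the denominator \<open>8 n^2 h^2\<close>
    equals \<open>2 \<alpha>^2\<close>.\<close>
  have c: "1 + 3 / (8 * (real n)\<^sup>2 * h\<^sup>2) = c"
    using assms(3,4) by (simp add: c_def h_def power_divide power_mult_distrib)
  have f: "continuous_on UNIV f" using assms(2) by (simp add: C_T_def)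
  have "best_approx (n - 1) f \<le> c * W2_star f 2 h"
    unfolding c[symmetric]
    by (rule best_approx_le_deviation[OF assms(2) h assms(4)]) (rule abs_deviation_le_W2_star[OF assms(2)], auto)
  \<comment> \<open>The same estimate with \<open>W = 2 * W2_star f 1 h\<close>, since the deviation
    for the hat is at most twice that for the box of the same \<open>u\<close>.\<close>
  moreover have "best_approx (n - 1) f \<le> c * (2 * W2_star f 1 h)"
    unfolding c[symmetric]
  proof (rule best_approx_le_deviation[OF assms(2) h assms(4)])
    fix u t assume u: "0 < u" "u \<le> h"
    have "\<bar>f x - conv f (chi u) x\<bar> \<le> W2_star f 1 h" for x
      using abs_deviation_le_W2_star[OF assms(2) u, of 1 x] by simp
    then show "\<bar>f t - conv f (chi_pow 2 u) t\<bar> \<le> 2 * W2_star f 1 h"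
      by (rule conv_chi_pow_2_deviation[OF u(1) f])
  qed
  ultimately show ?thesis unfolding h_def[symmetric] by (simp add: mult_ac)
qed

end
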